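(* Let $(T(t))_{t\ge 0}$ be a bounded $C_0$-semigroup on a Hilbert space $X$, with generator $-A$. Assume that $\sigma(A)\cap i\mathbb{R}=\{0\}$ and $$\|(is+A)^{-1}\|=\begin{cases}O\left(\dfrac{1}{|s|^{\alpha}\ell(1/|s|)}\right), & s\to 0,\\[2mm] O(1), & |s|\to\infty,\end{cases}$$ where $\alpha>1$ and $\ell$ is increasing and slowly varying. Then $$\|T(t)A(I+A)^{-1}\|=O\left(\frac{1}{(t\,\ell(t^{1/\alpha}))^{1/\alpha}}\right),\qquad t\to\infty.$$
   Context: A strictly positive measurable function $\ell$ on $[a,\infty)$ (for some $a$) is slowly varying if $\lim_{s\to\infty}\ell(\lambda s)/\ell(s)=1$ for every $\lambda>0$. "Increasing" means non-decreasing. The generator of the semigroup is $-A$; in the resolvent estimate $s$ is real. *)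

theory Defs
  imports "HOL-Analysis.Analysis" "HOL-Library.Landau_Symbols"
begin

text \<open>Complex Hilbert spaces. The real inner product (hence the norm and the topology) of the
  superclass is the one induced by the complex inner product, which is linear in its first
  argument.\<close>

class complex_hilbert_space = real_inner + complete_space +
  fixes scaleC :: "complex \<Rightarrow> 'a \<Rightarrow> 'a" (infixr \<open>*\<^sub>C\<close> 75)
    and cinner :: "'a \<Rightarrow> 'a \<Rightarrow> complex"
  assumes scaleC_add_right: "c *\<^sub>C (x + y) = c *\<^sub>C x + c *\<^sub>C y"
    and scaleC_add_left: "(c + d) *\<^sub>C x = c *\<^sub>C x + d *\<^sub>C x"
    and scaleC_scaleC: "c *\<^sub>C (d *\<^sub>C x) = (c * d) *\<^sub>C x"
    and scaleC_of_real: "complex_of_real r *\<^sub>C x = r *\<^sub>R x"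
    and cinner_commute: "cinner x y = cnj (cinner y x)"
    and cinner_add_left: "cinner (x + y) z = cinner x z + cinner y z"
    and cinner_scaleC_left: "cinner (c *\<^sub>C x) y = c * cinner x y"
    and inner_eq_Re_cinner: "inner x y = Re (cinner x y)"

instantiation complex :: complex_hilbert_space
begin

definition scaleC_complex :: "complex \<Rightarrow> complex \<Rightarrow> complex" where
  "scaleC_complex c x = c * x"

definition cinner_complex :: "complex \<Rightarrow> complex \<Rightarrow> complex" where
  "cinner_complex x y = x * cnj y"

instance
  by standard
    (simp_all add: scaleC_complex_def cinner_complex_def algebra_simps scaleR_conv_of_real
      inner_complex_def)

end

definition bounded_clinear :: "('a::complex_hilbert_space \<Rightarrow> 'a) \<Rightarrow> bool" where
  "bounded_clinear f \<longleftrightarrow> bounded_linear f \<and> (\<forall>c x. f (c *\<^sub>C x) = c *\<^sub>C f x)"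

definition C0_semigroup :: "(real \<Rightarrow> 'a::complex_hilbert_space \<Rightarrow> 'a) \<Rightarrow> bool" where
  "C0_semigroup T \<longleftrightarrow>
     (\<forall>t\<ge>0. bounded_clinear (T t)) \<and>
     (\<forall>x. T 0 x = x) \<and>
     (\<forall>s\<ge>0. \<forall>t\<ge>0. \<forall>x. T (s + t) x = T s (T t x)) \<and>
     (\<forall>x. continuous_on {0..} (\<lambda>t. T t x))"

definition bounded_semigroup :: "(real \<Rightarrow> 'a::complex_hilbert_space \<Rightarrow> 'a) \<Rightarrow> bool" where
  "bounded_semigroup T \<longleftrightarrow> (\<exists>M. \<forall>t\<ge>0. onorm (T t) \<le> M)"

text \<open>An unbounded operator is given by its domain \<open>D\<close> together with a function whose values
  outside \<open>D\<close> are irrelevant.\<close>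

definition is_generator ::
  "(real \<Rightarrow> 'a::complex_hilbert_space \<Rightarrow> 'a) \<Rightarrow> 'a set \<Rightarrow> ('a \<Rightarrow> 'a) \<Rightarrow> bool" where
  "is_generator T D B \<longleftrightarrow>
     D = {x. \<exists>y. ((\<lambda>h. (T h x - x) /\<^sub>R h) \<longlongrightarrow> y) (at_right 0)} \<and>
     (\<forall>x\<in>D. ((\<lambda>h. (T h x - x) /\<^sub>R h) \<longlongrightarrow> B x) (at_right 0))"

definition resolvent_set ::
  "'a::complex_hilbert_space set \<Rightarrow> ('a \<Rightarrow> 'a) \<Rightarrow> complex set" where
  "resolvent_set D A =
     {z. bij_betw (\<lambda>x. z *\<^sub>C x - A x) D UNIV \<and>
         bounded_clinear (inv_into D (\<lambda>x. z *\<^sub>C x - A x))}"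

definition spectrum ::
  "'a::complex_hilbert_space set \<Rightarrow> ('a \<Rightarrow> 'a) \<Rightarrow> complex set" where
  "spectrum D A = - resolvent_set D A"

definition slowly_varying :: "real \<Rightarrow> (real \<Rightarrow> real) \<Rightarrow> bool" where
  "slowly_varying a l \<longleftrightarrow>
     (\<forall>s\<ge>a. l s > 0) \<and>
     l \<in> borel_measurable (lebesgue_on {a..}) \<and>
     (\<forall>c>0. ((\<lambda>s. l (c * s) / l s) \<longlongrightarrow> 1) at_top)"

end

theory Submission
  imports Defs
begin

text \<open>Write \<open>R(z) = (z + A)\<^sup>-\<^sup>1\<close>, \<open>B = A (I + A)\<^sup>-\<^sup>1 = I - R(1)\<close>, let \<open>K\<close> bound the semigroup, and let
  \<open>r(t) = (t l(t powr (1/\<alpha>))) powr (-1/\<alpha>)\<close> be the claimed rate. Two facts give the theorem.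

  \<^item> If \<open>\<parallel>R(z) B\<parallel> \<le> q\<close> on the line \<open>Re z = 1/t\<close>, then \<open>\<parallel>T(t) B\<parallel>\<close> is at most a constant times \<open>q / t\<close>
    (\<open>orbit_decay\<close>). Cut the orbit off by a weight \<open>\<phi>\<close> that vanishes at \<open>0\<close> and \<open>2 t\<close>. Integration by parts
    shows that \<open>R(z) B\<close> with \<open>z = 1/t + i \<tau>\<close> maps the Fourier coefficient, at frequency \<open>\<tau>\<close>, of
    \<open>s \<mapsto> \<phi>'(s) exp (-s/t) T(s) x\<close> to that of \<open>s \<mapsto> \<phi>(s) exp (-s/t) T(s) B x\<close>. As the space is a Hilbert
    space, the bound \<open>q\<close> passes from coefficients to mean squares (\<open>fourier_multiplier_bound\<close>). The weight
    derivative contributes \<open>1/t\<close>, and \<open>\<parallel>T(t) B x\<parallel> \<le> K \<parallel>T(s) B x\<parallel>\<close> for \<open>s \<le> t\<close> turns the mean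
    square over \<open>[t/2, t]\<close> into a bound at time \<open>t\<close>.

  \<^item> On that line \<open>\<parallel>R(z) B\<parallel>\<close> is at most a constant times \<open>r(t) t\<close> (\<open>res_complement_bound\<close>). Here
    \<open>R(z) B = R(1) - z R(z) R(1)\<close>. For \<open>\<bar>\<tau>\<bar> \<le> r(t)\<close> \<open>\<bar>z\<bar>\<close> is at most \<open>2 r(t)\<close> and \<open>\<parallel>R(z)\<parallel> \<le> K t\<close>.
    Beyond \<open>r(t)\<close>, up to a fixed threshold, the resolvent is controlled by its value on the imaginary axis, and
    \<open>\<bar>\<tau>\<bar> / (\<bar>\<tau>\<bar> powr \<alpha> l(1/\<bar>\<tau>\<bar>))\<close> is, up to a constant, largest at \<open>\<bar>\<tau>\<bar> = r(t)\<close>, where it is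
    at most a constant times \<open>r(t) t\<close>; this is where \<open>\<alpha> > 1\<close> and the slow variation and monotonicity of \<open>l\<close> enter
    (\<open>rate_estimates\<close>). Above the threshold \<open>R(z)\<close> is bounded, and
    \<open>r(t) t\<close> is eventually at least \<open>1\<close>.

  The Fourier analysis is done with Fourier series on an interval and Fejer means, which only involves finite
  sums and integrals of continuous functions.\<close>

subclass (in complex_hilbert_space) banach ..

section \<open>Slow variation and the rate\<close>

lemma slowly_varying_dilation:
  assumes l: "slowly_varying a l" and c: "c > 0" and b: "b > 1"
  obtains u0 where "u0 \<ge> a" "u0 \<ge> 1" "\<And>u. u \<ge> u0 \<Longrightarrow> l (c * u) \<le> b * l u \<and> l u \<le> b * l (c * u)"
proof -
  have lim: "((\<lambda>s. l (c * s) / l s) \<longlongrightarrow> 1) at_top" and pos: "\<And>s. s \<ge> a \<Longrightarrow> l s > 0"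
    using l c by (auto simp: slowly_varying_def)
  have "1 / b < 1" using b by simp
  have "\<forall>\<^sub>F u in at_top. l (c * u) / l u < b \<and> 1 / b < l (c * u) / l u \<and> u \<ge> a \<and> u \<ge> 1"
    by (intro eventually_conj order_tendstoD[OF lim] b \<open>1 / b < 1\<close> eventually_ge_at_top)
  then obtain u0 where u0: "\<And>u. u \<ge> u0 \<Longrightarrow> l (c * u) / l u < b \<and> 1 / b < l (c * u) / l u \<and> u \<ge> a \<and> u \<ge> 1"
    by (auto simp: eventually_at_top_linorder)
  show ?thesis
  proof (rule that[of "u0"])
    fix u assume "u \<ge> u0"
    then show "l (c * u) \<le> b * l u \<and> l u \<le> b * l (c * u)"
      using u0[of u] pos[of u] b by (simp add: field_simps)
  qed (use u0[of u0] in auto)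
qed

text \<open>A Potter bound: a slowly varying function grows by at most the factor \<open>2 powr e\<close> over each doubling of the
  argument far out, and monotonicity interpolates between consecutive doublings.\<close>

lemma potter_bound:
  assumes l: "slowly_varying a l" and mono: "mono_on {a..} l" and e: "e > 0"
  obtains u0 where "u0 \<ge> a" "u0 \<ge> 1"
    "\<And>u v. u0 \<le> u \<Longrightarrow> u \<le> v \<Longrightarrow> l v \<le> 2 powr e * (v / u) powr e * l u"
proof -
  have "(2::real) powr e > 1" using e by (simp add: gr_one_powr)
  then obtain u0 where u0: "u0 \<ge> a" "u0 \<ge> 1"
    "\<And>u. u \<ge> u0 \<Longrightarrow> l (2 * u) \<le> 2 powr e * l u"
    using slowly_varying_dilation[OF l, of 2 "2 powr e"] by (metis zero_less_numeral)
  have iter: "l (2 ^ n * u) \<le> (2 powr e) ^ n * l u" if "u \<ge> u0" for n u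
  proof (induction n)
    case (Suc n)
    have "2 ^ n * u \<ge> 1 * u" using that u0 by (intro mult_right_mono) auto
    then have "l (2 * (2 ^ n * u)) \<le> 2 powr e * l (2 ^ n * u)" using that by (intro u0(3)) simp
    also have "\<dots> \<le> 2 powr e * ((2 powr e) ^ n * l u)" using Suc by (intro mult_left_mono) auto
    finally show ?case by (simp add: mult_ac)
  qed simp
  show ?thesis
  proof (rule that[OF u0(1,2)])
    fix u v assume uv: "u0 \<le> u" "u \<le> v"
    have u: "u > 0" "v / u \<ge> 1" using uv u0 by auto
    define n where "n = nat \<lfloor>log 2 (v / u)\<rfloor>"
    have log0: "log 2 (v / u) \<ge> 0" using u by simp
    have "real n = of_int \<lfloor>log 2 (v / u)\<rfloor>" using log0 by (simp add: n_def)
    then have n: "real n \<le> log 2 (v / u)" "log 2 (v / u) < real (Suc n)"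
      by linarith+
    have "v / u = 2 powr log 2 (v / u)" using u by simp
    also have "\<dots> \<le> 2 powr real (Suc n)" using n by (intro powr_mono) auto
    also have "\<dots> = 2 ^ Suc n" by (rule powr_realpow) simp
    finally have "v \<le> 2 ^ Suc n * u" using u by (simp add: field_simps)
    then have "l v \<le> l (2 ^ Suc n * u)"
      using uv u0 by (intro mono_onD[OF mono]) auto
    also have "\<dots> \<le> (2 powr e) ^ Suc n * l u" by (rule iter[OF uv(1)])
    also have "\<dots> \<le> 2 powr e * (v / u) powr e * l u"
    proof (intro mult_right_mono)
      have "(2 powr e) ^ n = (2 powr real n) powr e"
        by (simp add: powr_realpow[symmetric] powr_powr mult.commute)
      also have "\<dots> \<le> (2 powr log 2 (v / u)) powr e"
        using n e by (intro powr_mono2 powr_mono) auto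
      also have "2 powr log 2 (v / u) = v / u" using u by simp
      finally show "(2 powr e) ^ Suc n \<le> 2 powr e * (v / u) powr e" by (simp add: mult_left_mono)
      show "l u \<ge> 0" using l uv u0 by (auto simp: slowly_varying_def less_imp_le)
    qed
    finally show "l v \<le> 2 powr e * (v / u) powr e * l u" .
  qed
qed

text \<open>The function \<open>u / (u powr \<alpha> * l (1 / u))\<close> is regularly varying of index \<open>1 - \<alpha> < 0\<close> as \<open>u \<rightarrow> 0\<close>, hence almost
  decreasing, so it suffices to estimate it at \<open>u = r t\<close>. There it equals \<open>r t * t\<close> times
  \<open>l (t powr (1 / \<alpha>)) / l (1 / r t)\<close>. As \<open>l\<close> is increasing and so bounded away from zero, \<open>1 / r t\<close> exceeds
  a fixed multiple of \<open>t powr (1 / \<alpha>)\<close>, and slow variation bounds this quotient.\<close>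

lemma rate_estimates:
  fixes l :: "real \<Rightarrow> real"
  assumes l: "slowly_varying a l" and mono: "mono_on {a..} l" and \<alpha>: "\<alpha> > 1"
  defines "r \<equiv> \<lambda>t. 1 / (t * l (t powr (1 / \<alpha>))) powr (1 / \<alpha>)"
  obtains u0 C where "u0 \<ge> a" "u0 \<ge> 1" "C \<ge> 0"
    "\<forall>\<^sub>F t in at_top. r t > 0 \<and> r t * t \<ge> 1 \<and>
       (\<forall>u. r t \<le> u \<longrightarrow> u \<le> 1 / u0 \<longrightarrow> u * (1 / (u powr \<alpha> * l (1 / u))) \<le> C * (r t * t))"
proof -
  have pos: "\<And>s. s \<ge> a \<Longrightarrow> l s > 0" using l by (auto simp: slowly_varying_def)
  obtain u0 where u0: "u0 \<ge> a" "u0 \<ge> 1"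
    and pot: "\<And>u v. u0 \<le> u \<Longrightarrow> u \<le> v \<Longrightarrow> l v \<le> 2 powr (\<alpha> - 1) * (v / u) powr (\<alpha> - 1) * l u"
    using potter_bound[OF l mono, of "\<alpha> - 1"] \<alpha> by auto
  \<comment> \<open>In terms of \<open>T = t powr (1 / \<alpha>)\<close>, the claim \<open>r t * t \<ge> 1\<close> reads \<open>l T \<le> T powr (\<alpha> * (\<alpha> - 1))\<close>; growth with half of
      this exponent leaves room for the constant.\<close>
  define e where "e = \<alpha> * (\<alpha> - 1) / 2"
  have e: "e > 0" using \<alpha> by (simp add: e_def)
  obtain u1 where u1: "u1 \<ge> a" "u1 \<ge> 1"
    and grow: "\<And>u v. u1 \<le> u \<Longrightarrow> u \<le> v \<Longrightarrow> l v \<le> 2 powr e * (v / u) powr e * l u"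
    using potter_bound[OF l mono e] by auto
  define c where "c = l u0 powr (1 / \<alpha>)"
  have c: "c > 0" using pos[OF u0(1)] by (simp add: c_def)
  obtain u2 where u2: "u2 \<ge> a" "u2 \<ge> 1" and sv: "\<And>u. u \<ge> u2 \<Longrightarrow> l u \<le> 2 * l (c * u)"
    using slowly_varying_dilation[OF l c, of 2] by (metis one_less_numeral_iff semiring_norm(76))
  define G where "G = 2 powr e * l u1"
  have G: "G > 0" using pos[OF u1(1)] by (simp add: G_def)
  have T_top: "filterlim (\<lambda>t::real. t powr (1 / \<alpha>)) at_top at_top"
    unfolding filterlim_at_top
  proof
    fix Z :: real
    show "\<forall>\<^sub>F t in at_top. Z \<le> t powr (1 / \<alpha>)"
    proof (rule eventually_at_top_linorderI)
      fix t assume "t \<ge> max Z 1 powr \<alpha>"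
      then have "(max Z 1 powr \<alpha>) powr (1 / \<alpha>) \<le> t powr (1 / \<alpha>)"
        using \<alpha> by (intro powr_mono2) auto
      then show "Z \<le> t powr (1 / \<alpha>)" using \<alpha> by (simp add: powr_powr)
    qed
  qed
  have big: "\<forall>\<^sub>F T in at_top. T \<ge> u0 \<and> T \<ge> u1 \<and> T \<ge> u2 \<and> T \<ge> G powr (1 / e) \<and> T \<ge> \<bar>a\<bar> / c"
    by (intro eventually_conj eventually_ge_at_top)
  have "\<forall>\<^sub>F t in at_top. t powr (1 / \<alpha>) \<ge> u0 \<and> t powr (1 / \<alpha>) \<ge> u1 \<and> t powr (1 / \<alpha>) \<ge> u2
      \<and> t powr (1 / \<alpha>) \<ge> G powr (1 / e) \<and> t powr (1 / \<alpha>) \<ge> \<bar>a\<bar> / c"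
    using eventually_compose_filterlim[OF big T_top] .
  then have ev: "\<forall>\<^sub>F t in at_top. r t > 0 \<and> r t * t \<ge> 1 \<and>
       (\<forall>u. r t \<le> u \<longrightarrow> u \<le> 1 / u0 \<longrightarrow> u * (1 / (u powr \<alpha> * l (1 / u))) \<le> 2 * 2 powr (\<alpha> - 1) * (r t * t))"
    using eventually_gt_at_top[of 0]
  proof eventually_elim
    case (elim t)
    define T where "T = t powr (1 / \<alpha>)"
    have T: "T \<ge> u0" "T \<ge> u1" "T \<ge> u2" "T \<ge> G powr (1 / e)" "T \<ge> \<bar>a\<bar> / c" and t: "t > 0"
      using elim by (auto simp: T_def)
    have T1: "T \<ge> 1" using T u0 by simp
    have tT: "t = T powr \<alpha>" using t \<alpha> by (simp add: T_def powr_powr)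
    have lT: "l T > 0" using T u0 by (intro pos) simp
    define v where "v = (t * l T) powr (1 / \<alpha>)"
    have v: "v > 0" using t lT by (simp add: v_def)
    have r: "r t = 1 / v" by (simp add: r_def v_def T_def)
    have v\<alpha>: "v powr \<alpha> = t * l T" using t lT \<alpha> by (simp add: v_def powr_powr)
    have vT: "v = T * l T powr (1 / \<alpha>)" using t lT by (simp add: v_def powr_mult T_def)
    have rt: "r t * t \<ge> 1"
    proof -
      have "l T \<le> 2 powr e * (T / u1) powr e * l u1" by (rule grow) (use T in auto)
      also have "\<dots> \<le> 2 powr e * T powr e * l u1"
        using T1 u1 e pos[OF u1(1)] by (intro mult_right_mono mult_left_mono powr_mono2) (auto simp: field_simps)
      also have "\<dots> = G * T powr e" by (simp add: G_def)
      also have "\<dots> \<le> T powr e * T powr e"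
      proof (intro mult_right_mono)
        have "G = (G powr (1 / e)) powr e" using G e by (simp add: powr_powr)
        also have "\<dots> \<le> T powr e" using T e by (intro powr_mono2) auto
        finally show "G \<le> T powr e" .
      qed auto
      also have "\<dots> = T powr (\<alpha> * (\<alpha> - 1))" by (simp add: powr_add[symmetric] e_def)
      finally have "l T powr (1 / \<alpha>) \<le> (T powr (\<alpha> * (\<alpha> - 1))) powr (1 / \<alpha>)"
        using lT \<alpha> by (intro powr_mono2) auto
      also have "\<dots> = T powr (\<alpha> - 1)" using \<alpha> by (simp add: powr_powr)
      finally have "v \<le> T * T powr (\<alpha> - 1)" unfolding vT using T1 by (intro mult_left_mono) auto
      also have "\<dots> = t" using T1 by (simp add: tT powr_diff)
      finally show ?thesis using v by (simp add: r field_simps)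
    qed
    have lv: "l T \<le> 2 * l v"
    proof -
      have "c * T \<ge> a" using T(5) c by (simp add: field_simps)
      have "c * T \<le> v"
      proof -
        have "l u0 \<le> l T" using T u0 by (intro mono_onD[OF mono]) auto
        then have "c \<le> l T powr (1 / \<alpha>)"
          unfolding c_def using \<alpha> pos[OF u0(1)] by (intro powr_mono2) auto
        then show ?thesis unfolding vT using T1 by (simp add: mult.commute mult_left_mono)
      qed
      then have "l (c * T) \<le> l v" using \<open>c * T \<ge> a\<close> by (intro mono_onD[OF mono]) auto
      then show ?thesis using sv[OF T(3)] by simp
    qed
    have "u * (1 / (u powr \<alpha> * l (1 / u))) \<le> 2 * 2 powr (\<alpha> - 1) * (r t * t)"
      if u: "r t \<le> u" "u \<le> 1 / u0" for u
    proof -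
      define w where "w = 1 / u"
      have u_pos: "u > 0" using u(1) v by (auto simp: r intro: less_le_trans[of 0 "1 / v"])
      have w: "u0 \<le> w" "w \<le> v" "w > 0" "u = 1 / w"
        using u u_pos v u0 by (auto simp: w_def r field_simps)
      have lw: "l w > 0" and lv0: "l v > 0" using w u0 by (auto intro: pos)
      have "u * (1 / (u powr \<alpha> * l (1 / u))) = w powr (\<alpha> - 1) / l w"
        using w by (simp add: powr_diff powr_divide)
      also have "\<dots> \<le> 2 powr (\<alpha> - 1) * v powr (\<alpha> - 1) / l v"
      proof -
        have "l v \<le> 2 powr (\<alpha> - 1) * (v / w) powr (\<alpha> - 1) * l w" using w by (intro pot)
        also have "\<dots> = 2 powr (\<alpha> - 1) * v powr (\<alpha> - 1) * l w / w powr (\<alpha> - 1)"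
          using w v by (simp add: powr_divide)
        finally show ?thesis using w lw lv0 by (simp add: field_simps)
      qed
      also have "v powr (\<alpha> - 1) = r t * t * l T"
        using v by (simp add: powr_diff v\<alpha> r)
      also have "2 powr (\<alpha> - 1) * (r t * t * l T) / l v
          = 2 powr (\<alpha> - 1) * (r t * t) * (l T / l v)" by simp
      also have "\<dots> \<le> 2 powr (\<alpha> - 1) * (r t * t) * 2"
      proof (intro mult_left_mono)
        show "l T / l v \<le> 2" using lv lv0 by (simp add: pos_divide_le_eq)
        show "0 \<le> 2 powr (\<alpha> - 1) * (r t * t)" using t v by (simp add: r)
      qed
      finally show ?thesis by simp
    qed
    then show ?case using rt v by (auto simp: r)
  qed
  show ?thesis by (rule that[OF u0 _ ev]) simp
qed

section \<open>Complex scaling\<close>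

lemma cinner_self: "cinner x x = of_real ((norm (x::'a::complex_hilbert_space))\<^sup>2)"
proof (rule complex_eqI)
  show "Re (cinner x x) = Re (of_real ((norm x)\<^sup>2))"
    by (simp add: inner_eq_Re_cinner[symmetric] power2_norm_eq_inner)
  have "Im (cinner x x) = - Im (cinner x x)"
    using arg_cong[OF cinner_commute[of x x], of Im] by simp
  then show "Im (cinner x x) = Im (of_real ((norm x)\<^sup>2))" by simp
qed

lemma inner_scaleC_scaleC:
  "inner (c *\<^sub>C x) (d *\<^sub>C y) = Re (c * cnj d * cinner x (y::'a::complex_hilbert_space))"
proof -
  have "cinner x (d *\<^sub>C y) = cnj d * cinner x y"
    by (metis cinner_commute cinner_scaleC_left complex_cnj_mult)
  then show ?thesis
    by (simp add: inner_eq_Re_cinner cinner_scaleC_left mult.assoc)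
qed

lemma norm_scaleC: "norm (c *\<^sub>C (x::'a::complex_hilbert_space)) = cmod c * norm x"
proof -
  have "(norm (c *\<^sub>C x))\<^sup>2 = Re (c * cnj c * cinner x x)"
    by (simp only: power2_norm_eq_inner inner_scaleC_scaleC)
  also have "\<dots> = (cmod c * norm x)\<^sup>2"
    by (simp only: complex_norm_square[symmetric] cinner_self power_mult_distrib Re_complex_of_real
        of_real_mult[symmetric])
  finally show ?thesis
    by (simp add: power2_eq_iff_nonneg)
qed

lemma scaleC_scaleR: "c *\<^sub>C (r *\<^sub>R x) = r *\<^sub>R (c *\<^sub>C (x::'a::complex_hilbert_space))"
  by (metis mult.commute scaleC_of_real scaleC_scaleC)

interpretation scaleC: bounded_bilinear "scaleC :: complex \<Rightarrow> 'a::complex_hilbert_space \<Rightarrow> 'a"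
proof
  fix a a' :: complex and b b' :: 'a and r :: real
  show "(a + a') *\<^sub>C b = a *\<^sub>C b + a' *\<^sub>C b" by (rule scaleC_add_left)
  show "a *\<^sub>C (b + b') = a *\<^sub>C b + a *\<^sub>C b'" by (rule scaleC_add_right)
  show "(r *\<^sub>R a) *\<^sub>C b = r *\<^sub>R (a *\<^sub>C b)"
    by (simp add: scaleR_conv_of_real scaleC_scaleC[symmetric] scaleC_of_real)
  show "a *\<^sub>C (r *\<^sub>R b) = r *\<^sub>R (a *\<^sub>C b)" by (rule scaleC_scaleR)
  show "\<exists>K. \<forall>a b. norm (a *\<^sub>C (b::'a)) \<le> norm a * norm b * K"
    by (rule exI[of _ 1]) (simp add: norm_scaleC)
qed

lemma scaleC_one [simp]: "1 *\<^sub>C x = (x::'a::complex_hilbert_space)"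
  using scaleC_of_real[of 1 x] by simp

lemma integral_scaleC:
  "f integrable_on S \<Longrightarrow> integral S (\<lambda>s. c *\<^sub>C f s) = c *\<^sub>C integral S f"
  using integral_linear[OF _ scaleC.bounded_linear_right, of f S c] by (simp add: o_def)

lemma integrable_scaleC:
  "f integrable_on S \<Longrightarrow> (\<lambda>s. c *\<^sub>C f s) integrable_on S"
  using integrable_linear[OF _ scaleC.bounded_linear_right, of f S c] by (simp add: o_def)

section \<open>Fourier coefficients of vector-valued functions\<close>

definition fourier_coeff :: "real \<Rightarrow> (real \<Rightarrow> 'a::complex_hilbert_space) \<Rightarrow> int \<Rightarrow> 'a" where
  "fourier_coeff L f n = integral {0..L} (\<lambda>s. cis (- (2 * pi / L * n * s)) *\<^sub>C f s)"

text \<open>With \<open>w = 2 * pi / L\<close> this is \<open>N\<close> times the usual Fejer kernel of period \<open>L\<close>. Summing over pairs \<open>(j, k)\<close>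
  instead of weighting the frequencies \<open>j - k\<close> keeps all sums free of weights.\<close>

definition fejer :: "nat \<Rightarrow> real \<Rightarrow> real \<Rightarrow> real" where
  "fejer N w \<theta> = (\<Sum>j<N. \<Sum>k<N. cos (w * (real j - real k) * \<theta>))"

lemma fejer_eq: "fejer N w \<theta> = (cmod (\<Sum>j<N. cis (w * real j * \<theta>)))\<^sup>2"
proof -
  have "complex_of_real ((cmod (\<Sum>j<N. cis (w * real j * \<theta>)))\<^sup>2)
      = (\<Sum>j<N. \<Sum>k<N. cis (w * (real j - real k) * \<theta>))"
    unfolding complex_norm_square cnj_sum sum_product cis_cnj cis_mult
    by (simp add: algebra_simps)
  from arg_cong[OF this, of Re] show ?thesis
    unfolding fejer_def by (simp add: Re_sum)
qed

lemma fejer_nonneg: "fejer N w \<theta> \<ge> 0"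
  by (simp add: fejer_eq)

text \<open>The kernel is a squared geometric sum. The bound does not depend on \<open>N\<close>, whereas the mass of the kernel grows
  like \<open>N\<close>; this is what makes the Fejer means of Lipschitz functions converge.\<close>

lemma fejer_le: "fejer N w \<theta> * (cmod (1 - cis (w * \<theta>)))\<^sup>2 \<le> 4"
proof -
  have "(\<Sum>j<N. cis (w * real j * \<theta>)) = (\<Sum>j<N. cis (w * \<theta>) ^ j)"
    by (intro sum.cong refl) (simp only: Complex.DeMoivre, simp add: mult_ac)
  then have "(1 - cis (w * \<theta>)) * (\<Sum>j<N. cis (w * real j * \<theta>)) = 1 - cis (w * \<theta>) ^ N"
    by (simp add: one_diff_power_eq)
  then have "cmod (1 - cis (w * \<theta>)) * cmod (\<Sum>j<N. cis (w * real j * \<theta>)) = cmod (1 - cis (w * \<theta>) ^ N)"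
    by (metis norm_mult)
  also have "\<dots> \<le> 1 + 1"
    by (rule order_trans[OF norm_triangle_ineq4]) (simp add: norm_power)
  finally have "(cmod (1 - cis (w * \<theta>)) * cmod (\<Sum>j<N. cis (w * real j * \<theta>)))\<^sup>2 \<le> 2\<^sup>2"
    by (intro power_mono) auto
  then show ?thesis
    by (simp add: fejer_eq power_mult_distrib mult.commute)
qed

lemma continuous_on_fejer [continuous_intros]:
  fixes f :: "'b::t2_space \<Rightarrow> real"
  shows "continuous_on S f \<Longrightarrow> continuous_on S (\<lambda>x. fejer N w (f x))"
  unfolding fejer_def
  by (intro continuous_on_sum continuous_on_cos continuous_on_mult continuous_on_const)

lemma integral_cos_period:
  assumes "L > 0"
  shows "integral {0..L} (\<lambda>u. cos (2 * pi / L * of_int m * (s - u))) = (if m = 0 then L else 0)"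
proof (cases "m = 0")
  case False
  define c where "c = 2 * pi / L * of_int m"
  have c: "c \<noteq> 0" "c * L = 2 * pi * of_int m" using False assms by (auto simp: c_def)
  have "((\<lambda>u. cos (c * (s - u))) has_integral
      - sin (c * (s - L)) / c - - sin (c * (s - 0)) / c) {0..L}"
  proof (rule fundamental_theorem_of_calculus)
    show "((\<lambda>u. - sin (c * (s - u)) / c) has_vector_derivative cos (c * (s - u)))
        (at u within {0..L})" for u
      unfolding has_real_derivative_iff_has_vector_derivative[symmetric]
      by (rule derivative_eq_intros refl | use c in force)+
  qed (use assms in auto)
  moreover have "sin (c * (s - L)) = sin (c * s)"
  proof -
    have "sin (c * (s - L)) = sin (c * s - 2 * pi * of_int m)" using c by (simp add: algebra_simps)
    then show ?thesis by (simp add: sin_diff)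
  qed
  ultimately show ?thesis using False by (simp add: c_def integral_unique)
qed (use assms in simp)

lemma integral_fejer:
  assumes "L > 0"
  shows "integral {0..L} (\<lambda>u. fejer N (2 * pi / L) (s - u)) = real N * L"
proof -
  have "integral {0..L} (\<lambda>u. fejer N (2 * pi / L) (s - u))
      = (\<Sum>j<N. \<Sum>k<N. integral {0..L} (\<lambda>u. cos (2 * pi / L * (real j - real k) * (s - u))))"
    unfolding fejer_def
    by (subst integral_sum) (auto intro!: integrable_sum integrable_continuous_interval
        continuous_intros continuous_on_cos sum.cong integral_sum simp: assms[THEN less_imp_neq, symmetric])
  also have "\<dots> = (\<Sum>j<N. \<Sum>k<N. if int j - int k = 0 then L else 0)"
    using integral_cos_period[OF assms, of "int _ - int _" s] by (intro sum.cong refl) simp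
  also have "\<dots> = (\<Sum>j<N. L)"
    by (intro sum.cong refl) (simp add: sum.delta' cong: if_cong)
  finally show ?thesis by simp
qed

text \<open>Each squared norm of a coefficient is a double integral; summing over \<open>j\<close> and \<open>k\<close> produces the kernel.\<close>

lemma sum_fourier_coeff_eq:
  fixes f :: "real \<Rightarrow> 'a::complex_hilbert_space"
  assumes f: "continuous_on {0..L} f"
  shows "(\<Sum>j<N. \<Sum>k<N. (norm (fourier_coeff L f (int j - int k)))\<^sup>2)
       = integral (cbox (0,0) (L,L)) (\<lambda>(s,u). fejer N (2 * pi / L) (s - u) * inner (f s) (f u))"
proof -
  define e where "e n s = cis (- (2 * pi / L * of_int n * s)) *\<^sub>C f s" for n :: int and s :: real
  have ce: "continuous_on S (e n)" if "S \<subseteq> {0..L}" for n S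
    unfolding e_def by (intro continuous_intros scaleC.continuous_on continuous_on_subset[OF f that])
  have cee: "continuous_on (cbox (0,0) (L,L)) (\<lambda>(s,u). inner (e n s) (e n u))" for n
    unfolding split_def
    by (intro continuous_intros continuous_on_compose2[OF ce[OF order_refl]])
      (auto simp: cbox_Pair_eq)
  have coeff: "(norm (fourier_coeff L f n))\<^sup>2
      = integral (cbox (0,0) (L,L)) (\<lambda>(s,u). inner (e n s) (e n u))" for n
  proof -
    have int: "e n integrable_on {0..L}" for n
      by (intro integrable_continuous_interval ce order_refl)
    have c: "fourier_coeff L f n = integral {0..L} (e n)"
      unfolding fourier_coeff_def e_def ..
    have "(norm (fourier_coeff L f n))\<^sup>2 = inner (integral {0..L} (e n)) (integral {0..L} (e n))"
      by (simp add: c power2_norm_eq_inner)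
    also have "\<dots> = integral {0..L} (\<lambda>s. inner (e n s) (integral {0..L} (e n)))"
      using integral_linear[OF int bounded_linear_inner_left] by (simp add: o_def)
    also have "\<dots> = integral {0..L} (\<lambda>s. integral {0..L} (\<lambda>u. inner (e n s) (e n u)))"
      using integral_linear[OF int bounded_linear_inner_right] by (simp add: o_def)
    also have "\<dots> = integral (cbox (0,0) (L,L)) (\<lambda>(s,u). inner (e n s) (e n u))"
      using integral_prod_continuous[OF cee] by simp
    finally show ?thesis .
  qed
  have "(\<Sum>j<N. \<Sum>k<N. (norm (fourier_coeff L f (int j - int k)))\<^sup>2)
      = integral (cbox (0,0) (L,L)) (\<lambda>p. \<Sum>j<N. \<Sum>k<N.
           (\<lambda>(s,u). inner (e (int j - int k) s) (e (int j - int k) u)) p)"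
    unfolding coeff
    by (subst integral_sum) (auto intro!: integrable_sum integrable_continuous
        continuous_on_sum cee sum.cong integral_sum[symmetric])
  also have "\<dots> = integral (cbox (0,0) (L,L))
      (\<lambda>(s,u). fejer N (2 * pi / L) (s - u) * inner (f s) (f u))"
  proof (rule integral_cong)
    fix p :: "real \<times> real"
    obtain s u where p: "p = (s, u)" by fastforce
    let ?S = "\<Sum>j<N. cis (2 * pi / L * real j * (s - u))"
    have "(\<Sum>j<N. \<Sum>k<N. inner (e (int j - int k) s) (e (int j - int k) u))
        = Re ((\<Sum>j<N. \<Sum>k<N. cis (- (2 * pi / L * (real j - real k) * (s - u)))) * cinner (f s) (f u))"
      unfolding sum_distrib_right Re_sum
    proof (intro sum.cong refl)
      fix j k
      have "- (2 * pi / L * of_int (int j - int k) * s) + - (- (2 * pi / L * of_int (int j - int k) * u))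
          = - (2 * pi / L * (real j - real k) * (s - u))"
      proof -
        have "- (w * of_int (int j - int k) * s) + - (- (w * of_int (int j - int k) * u))
            = - (w * (real j - real k) * (s - u))" for w :: real
          by (simp add: algebra_simps)
        then show ?thesis .
      qed
      then show "inner (e (int j - int k) s) (e (int j - int k) u)
          = Re (cis (- (2 * pi / L * (real j - real k) * (s - u))) * cinner (f s) (f u))"
        unfolding e_def inner_scaleC_scaleC cis_cnj cis_mult by (simp only:)
    qed
    also have "(\<Sum>j<N. \<Sum>k<N. cis (- (2 * pi / L * (real j - real k) * (s - u)))) = cnj ?S * ?S"
    proof -
      have "- (w * (real j - real k) * (s - u)) = - (w * real j * (s - u)) + w * real k * (s - u)"
        for w :: real and j k :: nat
        by (simp add: algebra_simps)
      then show ?thesis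
        unfolding cnj_sum sum_product cis_cnj cis_mult by (simp only:)
    qed
    also have "\<dots> = of_real (fejer N (2 * pi / L) (s - u))"
      unfolding fejer_eq complex_norm_square by (rule mult.commute)
    finally show "(\<Sum>j<N. \<Sum>k<N. (\<lambda>(s,u). inner (e (int j - int k) s) (e (int j - int k) u)) p)
        = (\<lambda>(s,u). fejer N (2 * pi / L) (s - u) * inner (f s) (f u)) p"
      by (simp add: p inner_eq_Re_cinner)
  qed
  finally show ?thesis .
qed

text \<open>The exact defect in Parseval's identity at stage \<open>N\<close>, obtained by polarising the inner product under the double
  integral. It is nonnegative, which is Bessel's inequality, and it stays bounded in \<open>N\<close> for periodic Lipschitz
  functions, which is the converse inequality.\<close>

lemma fejer_parseval:
  fixes f :: "real \<Rightarrow> 'a::complex_hilbert_space"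
  assumes L: "L > 0" and f: "continuous_on {0..L} f"
  shows "2 * (real N * L * integral {0..L} (\<lambda>s. (norm (f s))\<^sup>2)
          - (\<Sum>j<N. \<Sum>k<N. (norm (fourier_coeff L f (int j - int k)))\<^sup>2))
       = integral (cbox (0,0) (L,L)) (\<lambda>(s,u). fejer N (2 * pi / L) (s - u) * (norm (f s - f u))\<^sup>2)"
proof -
  let ?Q = "cbox (0,0) (L,L) :: (real \<times> real) set" and ?F = "fejer N (2 * pi / L)"
  have c1: "continuous_on ?Q (\<lambda>x. f (fst x))" "continuous_on ?Q (\<lambda>x. f (snd x))"
    by (auto intro!: continuous_on_compose2[OF f] continuous_intros simp: cbox_Pair_eq)
  note ci = continuous_intros c1
  have cs: "continuous_on ?Q (\<lambda>(s,u). ?F (s - u) * (norm (f s))\<^sup>2)"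
    and cu: "continuous_on ?Q (\<lambda>(s,u). ?F (s - u) * (norm (f u))\<^sup>2)"
    and ci': "continuous_on ?Q (\<lambda>(s,u). ?F (s - u) * inner (f s) (f u))"
    unfolding split_def by (intro ci)+
  have Is: "integral ?Q (\<lambda>(s,u). ?F (s - u) * (norm (f s))\<^sup>2)
      = real N * L * integral {0..L} (\<lambda>s. (norm (f s))\<^sup>2)"
    using integral_prod_continuous[OF cs] by (simp add: integral_fejer[OF L])
  have sym: "?F (s - u) = ?F (u - s)" for s u
  proof -
    have "cos (w * (s - u)) = cos (w * (u - s))" for w
      by (metis cos_minus minus_diff_eq mult_minus_right)
    then show ?thesis unfolding fejer_def by (intro sum.cong refl)
  qed
  have Iu: "integral ?Q (\<lambda>(s,u). ?F (s - u) * (norm (f u))\<^sup>2)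
      = real N * L * integral {0..L} (\<lambda>s. (norm (f s))\<^sup>2)"
  proof -
    have "integral ?Q (\<lambda>(s,u). ?F (s - u) * (norm (f u))\<^sup>2)
        = integral {0..L} (\<lambda>s. integral {0..L} (\<lambda>u. ?F (s - u) * (norm (f u))\<^sup>2))"
      using integral_prod_continuous[OF cu] by simp
    also have "\<dots> = integral {0..L} (\<lambda>u. integral {0..L} (\<lambda>s. ?F (s - u) * (norm (f u))\<^sup>2))"
      using integral_swap_continuous[OF cu] by simp
    also have "\<dots> = integral {0..L} (\<lambda>u. real N * L * (norm (f u))\<^sup>2)"
    proof (rule integral_cong)
      fix u
      have "integral {0..L} (\<lambda>s. ?F (s - u)) = integral {0..L} (\<lambda>s. ?F (u - s))"
        by (rule integral_cong) (rule sym)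
      then show "integral {0..L} (\<lambda>s. ?F (s - u) * (norm (f u))\<^sup>2) = real N * L * (norm (f u))\<^sup>2"
        by (simp add: integral_fejer[OF L])
    qed
    finally show ?thesis by simp
  qed
  have "integral ?Q (\<lambda>(s,u). ?F (s - u) * (norm (f s - f u))\<^sup>2)
     = integral ?Q (\<lambda>p. ((\<lambda>(s,u). ?F (s - u) * (norm (f s))\<^sup>2) p
          + (\<lambda>(s,u). ?F (s - u) * (norm (f u))\<^sup>2) p)
          - 2 * (\<lambda>(s,u). ?F (s - u) * inner (f s) (f u)) p)"
    by (rule integral_cong)
      (auto simp: power2_norm_eq_inner inner_diff_left inner_diff_right inner_commute algebra_simps)
  also have "\<dots> = (integral ?Q (\<lambda>(s,u). ?F (s - u) * (norm (f s))\<^sup>2)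
      + integral ?Q (\<lambda>(s,u). ?F (s - u) * (norm (f u))\<^sup>2))
      - 2 * integral ?Q (\<lambda>(s,u). ?F (s - u) * inner (f s) (f u))"
    using integrable_continuous[OF cs] integrable_continuous[OF cu] integrable_continuous[OF ci']
    by (simp only: integral_diff integral_add integral_mult_right integrable_add integrable_on_mult_right)
  finally show ?thesis
    by (simp add: Is Iu sum_fourier_coeff_eq[OF f])
qed

lemma sum_fourier_coeff_le:
  fixes f :: "real \<Rightarrow> 'a::complex_hilbert_space"
  assumes "L > 0" "continuous_on {0..L} f"
  shows "(\<Sum>j<N. \<Sum>k<N. (norm (fourier_coeff L f (int j - int k)))\<^sup>2)
       \<le> real N * L * integral {0..L} (\<lambda>s. (norm (f s))\<^sup>2)"
proof -
  have "integral (cbox (0,0) (L,L))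
      (\<lambda>(s,u). fejer N (2 * pi / L) (s - u) * (norm (f s - f u))\<^sup>2) \<ge> 0"
    by (cases "(\<lambda>(s,u). fejer N (2 * pi / L) (s - u) * (norm (f s - f u))\<^sup>2) integrable_on cbox (0,0) (L,L)")
      (auto intro!: integral_nonneg simp: fejer_nonneg not_integrable_integral)
  then have "0 \<le> 2 * (real N * L * integral {0..L} (\<lambda>s. (norm (f s))\<^sup>2)
          - (\<Sum>j<N. \<Sum>k<N. (norm (fourier_coeff L f (int j - int k)))\<^sup>2))"
    by (simp only: fejer_parseval[OF assms])
  then show ?thesis by simp
qed

text \<open>A crude form of Jordan's inequality; the constant \<open>4\<close> in place of \<open>pi / 2\<close> does no harm.\<close>

lemma arg_le_sin:
  fixes y :: real
  assumes "0 \<le> y" "y \<le> pi / 2"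
  shows "y \<le> 4 * sin y"
proof (cases "y \<le> pi / 3")
  case True
  have "sin y \<ge> y / 2"
  proof (cases "y = 0")
    case False
    then have "y > 0" using assms by simp
    from MVT2[OF this, of sin cos] obtain z where z: "0 < z" "z < y" "sin y - sin 0 = (y - 0) * cos z"
      by (metis DERIV_sin)
    have "cos z \<ge> cos (pi / 3)" using z True by (intro cos_monotone_0_pi_le) auto
    then have "cos z \<ge> 1 / 2" by (simp add: cos_60)
    then have "y * cos z \<ge> y * (1 / 2)" using assms by (intro mult_left_mono) auto
    then show ?thesis using z by simp
  qed simp
  then show ?thesis using assms by simp
next
  case False
  have "sin y \<ge> sin (pi / 3)" using False assms by (intro sin_monotone_2pi_le) auto
  moreover have "sqrt 3 \<ge> 1" by simp
  ultimately have "sin y \<ge> 1 / 2" unfolding sin_60 by linarith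
  moreover have "y \<le> 2" using assms pi_half_less_two by simp
  ultimately show ?thesis by simp
qed

text \<open>As \<open>f 0 = f L\<close>, the two arguments may also be joined through the end point, so only their distance on the circle
  counts, and that distance is comparable with the chord.\<close>

lemma periodic_lipschitz:
  fixes f :: "real \<Rightarrow> 'a::real_normed_vector"
  assumes L: "L > 0" and lip: "\<And>s u. s \<in> {0..L} \<Longrightarrow> u \<in> {0..L} \<Longrightarrow> norm (f s - f u) \<le> C * \<bar>s - u\<bar>"
    and per: "f 0 = f L" and s: "s \<in> {0..L}" and u: "u \<in> {0..L}"
  shows "norm (f s - f u) \<le> C * L * cmod (1 - cis (2 * pi / L * (s - u)))"
proof -
  have C: "C \<ge> 0" using lip[of 0 L] L per by (auto simp: zero_le_mult_iff)
  have *: "norm (f s - f u) \<le> C * L * cmod (1 - cis (2 * pi / L * (s - u)))"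
    if "s \<in> {0..L}" "u \<in> {0..L}" "u \<le> s" for s u
  proof -
    \<comment> \<open>the distance of \<open>s\<close> and \<open>u\<close> on the circle\<close>
    define d where "d = min (s - u) (L - (s - u))"
    have d0: "0 \<le> d" using that by (auto simp: d_def)
    have "norm (f s - f u) \<le> C * (L - (s - u))"
    proof -
      have "norm (f s - f u) \<le> norm (f s - f L) + norm (f 0 - f u)"
        using norm_triangle_ineq[of "f s - f L" "f 0 - f u"] per by simp
      also have "\<dots> \<le> C * \<bar>s - L\<bar> + C * \<bar>0 - u\<bar>"
        using that L by (intro add_mono lip) auto
      also have "\<dots> = C * (L - (s - u))" using that by (simp add: algebra_simps)
      finally show ?thesis .
    qed
    moreover have "norm (f s - f u) \<le> C * (s - u)" using lip[OF that(1,2)] that by simp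
    ultimately have "norm (f s - f u) \<le> C * d" by (simp add: d_def min_def)
    also have "\<dots> \<le> C * (L * cmod (1 - cis (2 * pi / L * (s - u))))"
    proof (intro mult_left_mono C)
      have "sin (pi / L * (s - u)) = sin (pi / L * d)"
      proof (cases "s - u \<le> L - (s - u)")
        case False
        have "pi / L * d = pi - pi / L * (s - u)" using False L by (simp add: d_def min_def field_simps)
        then show ?thesis by simp
      qed (simp add: d_def)
      moreover have "cmod (1 - cis (2 * pi / L * (s - u))) = 2 * \<bar>sin (pi / L * (s - u))\<bar>"
      proof -
        define y where "y = pi / L * (s - u)"
        have "(cmod (1 - cis (2 * y)))\<^sup>2 = (1 - cos (2 * y))\<^sup>2 + (sin (2 * y))\<^sup>2"
          by (simp add: cmod_power2)
        also have "\<dots> = 4 * (sin y)\<^sup>2"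
          unfolding cos_double_sin sin_double power_mult_distrib cos_squared_eq by algebra
        finally have "(cmod (1 - cis (2 * y)))\<^sup>2 = (2 * \<bar>sin y\<bar>)\<^sup>2" by (simp add: power_mult_distrib)
        then have "cmod (1 - cis (2 * y)) = 2 * \<bar>sin y\<bar>" by (rule power2_eq_imp_eq) auto
        moreover have "2 * y = 2 * pi / L * (s - u)" by (simp add: y_def)
        ultimately show ?thesis by (simp only: y_def)
      qed
      moreover have "pi / L * d \<le> 4 * sin (pi / L * d)"
        using d0 L by (intro arg_le_sin) (auto simp: d_def field_simps min_def)
      moreover have "pi / L * d \<ge> 2 * (d / L)"
        using d0 L pi_ge_two by (simp add: divide_right_mono mult_right_mono)
      ultimately have "d / L \<le> cmod (1 - cis (2 * pi / L * (s - u)))" by linarith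
      then show "d \<le> L * cmod (1 - cis (2 * pi / L * (s - u)))" using L by (simp add: field_simps)
    qed
    finally show ?thesis by (simp add: mult.assoc)
  qed
  show ?thesis
  proof (cases "u \<le> s")
    case False
    have "cmod (1 - cis (2 * pi / L * (u - s))) = cmod (1 - cis (2 * pi / L * (s - u)))"
    proof -
      have "1 - cis (2 * pi / L * (u - s)) = cnj (1 - cis (2 * pi / L * (s - u)))"
        using minus_mult_right[of "2 * pi / L" "s - u"] by (simp add: cis_cnj)
      then show ?thesis by (metis complex_mod_cnj)
    qed
    then show ?thesis using *[OF u s] False by (simp add: norm_minus_commute)
  qed (use * s u in auto)
qed

text \<open>The kernel bound cancels the squared chord that \<open>periodic_lipschitz\<close> provides.\<close>

lemma integral_norm_le_sum_fourier_coeff: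
  fixes f :: "real \<Rightarrow> 'a::complex_hilbert_space"
  assumes L: "L > 0" and lip: "\<And>s u. s \<in> {0..L} \<Longrightarrow> u \<in> {0..L} \<Longrightarrow> norm (f s - f u) \<le> C * \<bar>s - u\<bar>"
    and per: "f 0 = f L" and f: "continuous_on {0..L} f"
  shows "real N * L * integral {0..L} (\<lambda>s. (norm (f s))\<^sup>2)
       \<le> (\<Sum>j<N. \<Sum>k<N. (norm (fourier_coeff L f (int j - int k)))\<^sup>2) + 2 * (C * L)\<^sup>2 * L\<^sup>2"
proof -
  let ?Q = "cbox (0,0) (L,L) :: (real \<times> real) set"
  have c1: "continuous_on ?Q (\<lambda>x. f (fst x))" "continuous_on ?Q (\<lambda>x. f (snd x))"
    by (auto intro!: continuous_on_compose2[OF f] continuous_intros simp: cbox_Pair_eq)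
  have "integral ?Q (\<lambda>(s,u). fejer N (2 * pi / L) (s - u) * (norm (f s - f u))\<^sup>2)
     \<le> integral ?Q (\<lambda>(s,u). 4 * (C * L)\<^sup>2)"
  proof (rule integral_le)
    show "(\<lambda>(s,u). fejer N (2 * pi / L) (s - u) * (norm (f s - f u))\<^sup>2) integrable_on ?Q"
      unfolding split_def by (intro integrable_continuous continuous_intros c1)
    show "(\<lambda>(s,u). 4 * (C * L)\<^sup>2) integrable_on ?Q"
      unfolding split_def by (intro integrable_continuous continuous_intros)
    fix p :: "real \<times> real" assume "p \<in> ?Q"
    then obtain s u where p: "p = (s,u)" and su: "s \<in> {0..L}" "u \<in> {0..L}"
      by (cases p) (auto simp: cbox_Pair_eq)
    let ?c = "cmod (1 - cis (2 * pi / L * (s - u)))"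
    have "(norm (f s - f u))\<^sup>2 \<le> (C * L * ?c)\<^sup>2"
      by (intro power_mono periodic_lipschitz L lip per su) auto
    then have "fejer N (2 * pi / L) (s - u) * (norm (f s - f u))\<^sup>2
        \<le> fejer N (2 * pi / L) (s - u) * (C * L * ?c)\<^sup>2"
      by (intro mult_left_mono fejer_nonneg)
    also have "\<dots> = (fejer N (2 * pi / L) (s - u) * ?c\<^sup>2) * (C * L)\<^sup>2"
      by (simp add: power_mult_distrib)
    also have "\<dots> \<le> 4 * (C * L)\<^sup>2"
      by (intro mult_right_mono fejer_le) auto
    finally show "(case p of (s,u) \<Rightarrow> fejer N (2 * pi / L) (s - u) * (norm (f s - f u))\<^sup>2)
        \<le> (case p of (s,u) \<Rightarrow> 4 * (C * L)\<^sup>2)" by (simp add: p)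
  qed
  also have "\<dots> = 4 * (C * L)\<^sup>2 * L\<^sup>2"
    using L by (simp add: split_def content_Pair power2_eq_square)
  finally have "2 * (real N * L * integral {0..L} (\<lambda>s. (norm (f s))\<^sup>2)
          - (\<Sum>j<N. \<Sum>k<N. (norm (fourier_coeff L f (int j - int k)))\<^sup>2)) \<le> 4 * (C * L)\<^sup>2 * L\<^sup>2"
    by (simp only: fejer_parseval[OF L f])
  then show ?thesis by simp
qed

text \<open>Bessel's inequality for \<open>g\<close> and its converse for \<open>f\<close> carry a bound between coefficients over to the mean squares.
  The error term of the converse does not grow with \<open>N\<close> while the main terms do, so it disappears.\<close>

lemma fourier_multiplier_bound:
  fixes f g :: "real \<Rightarrow> 'a::complex_hilbert_space"
  assumes L: "L > 0" and lip: "\<And>s u. s \<in> {0..L} \<Longrightarrow> u \<in> {0..L} \<Longrightarrow> norm (f s - f u) \<le> C * \<bar>s - u\<bar>"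
    and per: "f 0 = f L" and f: "continuous_on {0..L} f" and g: "continuous_on {0..L} g"
    and le: "\<And>n. norm (fourier_coeff L f n) \<le> q * norm (fourier_coeff L g n)"
  shows "integral {0..L} (\<lambda>s. (norm (f s))\<^sup>2) \<le> q\<^sup>2 * integral {0..L} (\<lambda>s. (norm (g s))\<^sup>2)"
proof (rule ccontr)
  let ?F = "integral {0..L} (\<lambda>s. (norm (f s))\<^sup>2)" and ?G = "integral {0..L} (\<lambda>s. (norm (g s))\<^sup>2)"
  assume "\<not> ?thesis"
  then have pos: "L * (?F - q\<^sup>2 * ?G) > 0" using L by simp
  then obtain N :: nat where "2 * (C * L)\<^sup>2 * L\<^sup>2 < real N * (L * (?F - q\<^sup>2 * ?G))"
    using reals_Archimedean3 by blast
  moreover have "(\<Sum>j<N. \<Sum>k<N. (norm (fourier_coeff L f (int j - int k)))\<^sup>2)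
      \<le> (\<Sum>j<N. \<Sum>k<N. q\<^sup>2 * (norm (fourier_coeff L g (int j - int k)))\<^sup>2)"
    by (intro sum_mono) (metis le norm_ge_zero power_mono power_mult_distrib)
  moreover have "\<dots> \<le> q\<^sup>2 * (real N * L * ?G)"
    unfolding sum_distrib_left[symmetric] by (intro mult_left_mono sum_fourier_coeff_le L g) auto
  ultimately show False
    using integral_norm_le_sum_fourier_coeff[OF L lip per f, of N] by (simp add: algebra_simps)
qed

lemma C1_imp_lipschitz:
  fixes f :: "real \<Rightarrow> 'a::real_normed_vector"
  assumes f: "\<And>s. s \<in> {a..b} \<Longrightarrow> (f has_vector_derivative f' s) (at s within {a..b})"
    and f': "continuous_on {a..b} f'"
  obtains C where "\<And>s u. s \<in> {a..b} \<Longrightarrow> u \<in> {a..b} \<Longrightarrow> norm (f s - f u) \<le> C * \<bar>s - u\<bar>"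
proof -
  have "bounded (f' ` {a..b})"
    by (intro compact_imp_bounded compact_continuous_image f') simp
  then obtain C where "\<forall>v\<in>f' ` {a..b}. norm v \<le> C"
    unfolding bounded_iff by blast
  then have C: "norm (f' s) \<le> C" if "s \<in> {a..b}" for s
    using that by blast
  have "norm (f s - f u) \<le> C * norm (s - u)" if "s \<in> {a..b}" "u \<in> {a..b}" for s u
  proof (rule differentiable_bound[where f' = "\<lambda>s h. h *\<^sub>R f' s"])
    fix x assume x: "x \<in> {a..b}"
    show "(f has_derivative (\<lambda>h. h *\<^sub>R f' x)) (at x within {a..b})"
      using f[OF x] by (simp add: has_vector_derivative_def)
    show "onorm (\<lambda>h. h *\<^sub>R f' x) \<le> C"
    proof (rule onorm_le)
      show "norm (h *\<^sub>R f' x) \<le> C * norm h" for h :: real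
        using mult_right_mono[OF C[OF x], of "norm h"] by (simp add: mult.commute)
    qed
  qed (use that in auto)
  then show ?thesis by (intro that[of C]) simp
qed

section \<open>Resolvents of the generator of a bounded semigroup\<close>

locale bounded_C0_semigroup =
  fixes T :: "real \<Rightarrow> 'a::complex_hilbert_space \<Rightarrow> 'a" and D :: "'a set" and A :: "'a \<Rightarrow> 'a"
    and K :: real
  assumes semigroup: "C0_semigroup T"
    and generator: "is_generator T D (\<lambda>x. - A x)"
    and bound: "t \<ge> 0 \<Longrightarrow> norm (T t x) \<le> K * norm x"
    and K_ge_1: "K \<ge> 1"
begin

lemma linear_T: "t \<ge> 0 \<Longrightarrow> bounded_linear (T t)"
  and T_scaleC: "t \<ge> 0 \<Longrightarrow> T t (c *\<^sub>C x) = c *\<^sub>C T t x"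
  and T_0 [simp]: "T 0 x = x"
  and T_add: "s \<ge> 0 \<Longrightarrow> t \<ge> 0 \<Longrightarrow> T (s + t) x = T s (T t x)"
  and continuous_T: "continuous_on {0..} (\<lambda>t. T t x)"
  using semigroup by (auto simp: C0_semigroup_def bounded_clinear_def)

lemma T_commute: "s \<ge> 0 \<Longrightarrow> t \<ge> 0 \<Longrightarrow> T s (T t x) = T t (T s x)"
  by (metis T_add add.commute)

lemma continuous_on_T: "S \<subseteq> {0..} \<Longrightarrow> continuous_on S (\<lambda>t. T t x)"
  by (rule continuous_on_subset[OF continuous_T])

lemma generator_tendsto: "x \<in> D \<Longrightarrow> ((\<lambda>h. (T h x - x) /\<^sub>R h) \<longlongrightarrow> - A x) (at_right 0)"
  using generator by (auto simp: is_generator_def)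

lemma generatorI:
  assumes "((\<lambda>h. (T h x - x) /\<^sub>R h) \<longlongrightarrow> y) (at_right 0)"
  shows "x \<in> D" "A x = - y"
proof -
  show D: "x \<in> D" using assms generator by (auto simp: is_generator_def)
  have "- A x = y"
    using tendsto_unique[OF _ generator_tendsto[OF D] assms] by simp
  then show "A x = - y" by auto
qed

lemma eventually_nonneg_at_right: "eventually (\<lambda>h::real. h \<ge> 0) (at_right 0)"
  by (rule eventually_mono[OF eventually_at_right_less]) simp

lemma add_in_D: "x \<in> D \<Longrightarrow> y \<in> D \<Longrightarrow> x + y \<in> D"
  and A_add: "x \<in> D \<Longrightarrow> y \<in> D \<Longrightarrow> A (x + y) = A x + A y"
proof -
  assume D: "x \<in> D" "y \<in> D"
  have "((\<lambda>h. (T h (x + y) - (x + y)) /\<^sub>R h) \<longlongrightarrow> - A x + - A y) (at_right 0)"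
  proof (rule Lim_transform_eventually[OF tendsto_add[OF generator_tendsto[OF D(1)] generator_tendsto[OF D(2)]]])
    show "\<forall>\<^sub>F h in at_right 0. (T h x - x) /\<^sub>R h + (T h y - y) /\<^sub>R h = (T h (x + y) - (x + y)) /\<^sub>R h"
      using eventually_nonneg_at_right
      by eventually_elim (simp add: linear_add[OF bounded_linear.linear[OF linear_T]] scaleR_add_right[symmetric])
  qed
  from generatorI[OF this] show "x + y \<in> D" "A (x + y) = A x + A y" by auto
qed

lemma scaleC_in_D: "x \<in> D \<Longrightarrow> c *\<^sub>C x \<in> D"
  and A_scaleC: "x \<in> D \<Longrightarrow> A (c *\<^sub>C x) = c *\<^sub>C A x"
proof -
  assume D: "x \<in> D"
  have "((\<lambda>h. (T h (c *\<^sub>C x) - (c *\<^sub>C x)) /\<^sub>R h) \<longlongrightarrow> c *\<^sub>C (- A x)) (at_right 0)"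
  proof (rule Lim_transform_eventually[OF scaleC.tendsto[OF tendsto_const generator_tendsto[OF D]]])
    show "\<forall>\<^sub>F h in at_right 0. c *\<^sub>C ((T h x - x) /\<^sub>R h) = (T h (c *\<^sub>C x) - (c *\<^sub>C x)) /\<^sub>R h"
      using eventually_nonneg_at_right
      by eventually_elim (simp add: T_scaleC scaleC.diff_right scaleC_scaleR)
  qed
  from generatorI[OF this] show "c *\<^sub>C x \<in> D" "A (c *\<^sub>C x) = c *\<^sub>C A x"
    by (auto simp: scaleC.minus_right)
qed

lemma minus_in_D: "x \<in> D \<Longrightarrow> - x \<in> D" and A_minus: "x \<in> D \<Longrightarrow> A (- x) = - A x"
  using scaleC_in_D[of x "-1"] A_scaleC[of x "-1"] by (auto simp: scaleC.minus_left)

lemma diff_in_D: "x \<in> D \<Longrightarrow> y \<in> D \<Longrightarrow> x - y \<in> D"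
  and A_diff: "x \<in> D \<Longrightarrow> y \<in> D \<Longrightarrow> A (x - y) = A x - A y"
  using add_in_D[of x "-y"] A_add[of x "-y"] minus_in_D A_minus by auto

lemma T_in_D: "x \<in> D \<Longrightarrow> s \<ge> 0 \<Longrightarrow> T s x \<in> D"
  and A_T: "x \<in> D \<Longrightarrow> s \<ge> 0 \<Longrightarrow> A (T s x) = T s (A x)"
proof -
  assume D: "x \<in> D" and s: "s \<ge> 0"
  interpret bounded_linear "T s" by (rule linear_T[OF s])
  have neg: "T s (- y) = - T s y" for y using diff[of 0 y] zero by simp
  have "((\<lambda>h. (T h (T s x) - T s x) /\<^sub>R h) \<longlongrightarrow> T s (- A x)) (at_right 0)"
  proof (rule Lim_transform_eventually[OF tendsto[OF generator_tendsto[OF D]]])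
    show "\<forall>\<^sub>F h in at_right 0. T s ((T h x - x) /\<^sub>R h) = (T h (T s x) - T s x) /\<^sub>R h"
      using eventually_nonneg_at_right
      by eventually_elim (simp add: scaleR diff T_commute s)
  qed
  from generatorI[OF this] show "T s x \<in> D" "A (T s x) = T s (A x)" by (auto simp: neg)
qed

text \<open>The generator only yields the derivative from the right. From the left, \<open>T u x - T s x\<close> with \<open>u < s\<close> is the
  image of a difference quotient at \<open>0\<close> under \<open>T u\<close>, and uniform boundedness together with continuity of
  \<open>u \<mapsto> T u (A x)\<close> controls it.\<close>

lemma orbit_has_vector_derivative:
  assumes x: "x \<in> D" and s: "s \<ge> 0"
  shows "((\<lambda>s. T s x) has_vector_derivative - T s (A x)) (at s within {0..})"
  unfolding has_vector_derivative_def has_derivative_within_alt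
proof (intro conjI allI impI)
  show "bounded_linear (\<lambda>h. h *\<^sub>R - T s (A x))" by (rule bounded_linear_scaleR_left)
  fix e :: real assume e: "e > 0"
  define e' where "e' = e / (2 * K)"
  have e': "e' > 0" "K * e' = e / 2" using e K_ge_1 by (auto simp: e'_def)
  from tendstoD[OF generator_tendsto[OF x] e'(1)] obtain d1 where d1: "d1 > 0"
    "\<And>h. 0 < h \<Longrightarrow> h < d1 \<Longrightarrow> dist ((T h x - x) /\<^sub>R h) (- A x) < e'"
    unfolding eventually_at_right_field by auto
  have quot: "norm (T h x - x + h *\<^sub>R A x) \<le> e' * h" if "0 < h" "h < d1" for h
  proof -
    have "T h x - x + h *\<^sub>R A x = h *\<^sub>R ((T h x - x) /\<^sub>R h - (- A x))"
      using that by (simp add: scaleR_add_right)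
    then have "norm (T h x - x + h *\<^sub>R A x) = h * dist ((T h x - x) /\<^sub>R h) (- A x)"
      using that by (simp add: dist_norm)
    also have "\<dots> \<le> h * e'" using d1(2)[OF that] that by (intro mult_left_mono) auto
    finally show ?thesis by (simp add: mult.commute)
  qed
  have "e / 2 > 0" using e by simp
  from continuous_T[of "A x", unfolded continuous_on_iff, rule_format, OF _ this, of s] s
  obtain d2 where d2: "d2 > 0"
    "\<And>u. u \<ge> 0 \<Longrightarrow> dist u s < d2 \<Longrightarrow> dist (T u (A x)) (T s (A x)) < e / 2" by auto
  show "\<exists>d>0. \<forall>y\<in>{0..}. norm (y - s) < d \<longrightarrow>
      norm (T y x - T s x - (y - s) *\<^sub>R - T s (A x)) \<le> e * norm (y - s)"
  proof (intro exI[of _ "min d1 d2"] conjI ballI impI)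
    fix u assume u: "u \<in> {0..}" "norm (u - s) < min d1 d2"
    consider "u = s" | "u > s" | "u < s" by linarith
    then show "norm (T u x - T s x - (u - s) *\<^sub>R - T s (A x)) \<le> e * norm (u - s)"
    proof cases
      case 2
      interpret bounded_linear "T s" by (rule linear_T[OF s])
      have "T u x = T s (T (u - s) x)" using T_add[of s "u - s" x] s 2 by simp
      then have "T u x - T s x - (u - s) *\<^sub>R - T s (A x)
          = T s (T (u - s) x - x + (u - s) *\<^sub>R A x)"
        by (simp add: add diff scaleR)
      then have "norm (T u x - T s x - (u - s) *\<^sub>R - T s (A x))
          \<le> K * norm (T (u - s) x - x + (u - s) *\<^sub>R A x)"
        using bound[OF s] by simp
      also have "\<dots> \<le> K * (e' * (u - s))"
        using quot[of "u - s"] u 2 K_ge_1 by (intro mult_left_mono) auto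
      also have "\<dots> = (K * e') * (u - s)" by simp
      also have "\<dots> \<le> e * norm (u - s)"
        using e 2 unfolding e'(2) by (intro mult_mono) auto
      finally show ?thesis .
    next
      case 3
      have u0: "u \<ge> 0" using u by simp
      interpret bounded_linear "T u" by (rule linear_T[OF u0])
      have "T s x = T u (T (s - u) x)" using T_add[of u "s - u" x] u0 3 by simp
      then have "T u x - T s x - (u - s) *\<^sub>R - T s (A x)
          = - T u (T (s - u) x - x + (s - u) *\<^sub>R A x) + (s - u) *\<^sub>R (T u (A x) - T s (A x))"
        by (simp add: add diff scaleR algebra_simps)
      then have "norm (T u x - T s x - (u - s) *\<^sub>R - T s (A x))
          \<le> norm (T u (T (s - u) x - x + (s - u) *\<^sub>R A x)) + (s - u) * norm (T u (A x) - T s (A x))"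
        using norm_triangle_ineq[of "- T u (T (s - u) x - x + (s - u) *\<^sub>R A x)"
            "(s - u) *\<^sub>R (T u (A x) - T s (A x))"] 3 by simp
      also have "\<dots> \<le> K * (e' * (s - u)) + (s - u) * (e / 2)"
      proof (intro add_mono)
        show "norm (T u (T (s - u) x - x + (s - u) *\<^sub>R A x)) \<le> K * (e' * (s - u))"
          using quot[of "s - u"] u 3 K_ge_1
          by (intro order_trans[OF bound[OF u0]] mult_left_mono) auto
        show "(s - u) * norm (T u (A x) - T s (A x)) \<le> (s - u) * (e / 2)"
          using d2(2)[OF u0] u 3 by (intro mult_left_mono) (auto simp: dist_norm less_imp_le)
      qed
      also have "K * (e' * (s - u)) = (K * e') * (s - u)" by simp
      also have "\<dots> + (s - u) * (e / 2) = e * norm (u - s)"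
        unfolding e'(2) using 3 by (simp add: field_simps)
      finally show ?thesis .
    qed simp
  qed (use d1 d2 in auto)
qed

lemma integral_by_parts:
  fixes c c' :: "real \<Rightarrow> complex"
  assumes L: "L \<ge> 0" and c: "\<And>s. (c has_vector_derivative c' s) (at s)"
    and c': "continuous_on {0..L} c'" and w: "w \<in> D"
  shows "integral {0..L} (\<lambda>s. c s *\<^sub>C T s (A w))
       = integral {0..L} (\<lambda>s. c' s *\<^sub>C T s w) - (c L *\<^sub>C T L w - c 0 *\<^sub>C w)"
proof -
  have cont: "continuous_on {0..L} c"
    using c by (meson continuous_at_imp_continuous_on has_vector_derivative_continuous)
  have "((\<lambda>s. c s *\<^sub>C (- T s (A w)) + c' s *\<^sub>C T s w) has_integral (c L *\<^sub>C T L w - c 0 *\<^sub>C T 0 w)) {0..L}"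
  proof (rule fundamental_theorem_of_calculus[OF L])
    fix s assume "s \<in> {0..L}"
    then have "((\<lambda>s. T s w) has_vector_derivative - T s (A w)) (at s within {0..L})"
      using orbit_has_vector_derivative[OF w, of s] by (auto intro: has_vector_derivative_within_subset)
    then show "((\<lambda>s. c s *\<^sub>C T s w) has_vector_derivative
        c s *\<^sub>C (- T s (A w)) + c' s *\<^sub>C T s w) (at s within {0..L})"
      by (intro scaleC.has_vector_derivative has_vector_derivative_at_within[OF c])
  qed
  moreover have "(\<lambda>s. c s *\<^sub>C T s (A w)) integrable_on {0..L}"
    "(\<lambda>s. c' s *\<^sub>C T s w) integrable_on {0..L}"
    by (intro integrable_continuous_interval scaleC.continuous_on cont c' continuous_on_T; auto)+
  ultimately have "integral {0..L} (\<lambda>s. c' s *\<^sub>C T s w) - integral {0..L} (\<lambda>s. c s *\<^sub>C T s (A w))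
      = c L *\<^sub>C T L w - c 0 *\<^sub>C w"
    by (subst integral_diff[symmetric]) (auto simp: scaleC.minus_right dest!: integral_unique)
  then show ?thesis by (simp add: algebra_simps)
qed

text \<open>Since \<open>- A\<close> is the generator, the resolvent is indexed by the point \<open>z\<close> of its Laplace transform, that is, it inverts
  \<open>z + A\<close>; thus \<open>regular z\<close> expresses that \<open>- z\<close> belongs to the resolvent set of \<open>A\<close>.\<close>

definition res :: "complex \<Rightarrow> 'a \<Rightarrow> 'a" where
  "res z = inv_into D (\<lambda>x. z *\<^sub>C x + A x)"

definition regular :: "complex \<Rightarrow> bool" where
  "regular z \<longleftrightarrow> bij_betw (\<lambda>x. z *\<^sub>C x + A x) D UNIV \<and> bounded_linear (res z)"

lemma res_in_D: "regular z \<Longrightarrow> res z x \<in> D"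
  and res_right: "regular z \<Longrightarrow> z *\<^sub>C res z x + A (res z x) = x"
  unfolding regular_def res_def bij_betw_def
  using inv_into_into[of x "\<lambda>x. z *\<^sub>C x + A x" D] f_inv_into_f[of x "\<lambda>x. z *\<^sub>C x + A x" D] by auto

lemma res_eqI: "regular z \<Longrightarrow> y \<in> D \<Longrightarrow> z *\<^sub>C y + A y = x \<Longrightarrow> res z x = y"
  unfolding regular_def res_def bij_betw_def
  using inv_into_f_f[of "\<lambda>x. z *\<^sub>C x + A x" D y] by auto

lemma A_res: "regular z \<Longrightarrow> A (res z x) = x - z *\<^sub>C res z x"
  using res_right[of z x] by (simp add: algebra_simps)

lemma bounded_linear_res: "regular z \<Longrightarrow> bounded_linear (res z)"
  by (simp add: regular_def)

lemma res_scaleC: "regular z \<Longrightarrow> res z (c *\<^sub>C x) = c *\<^sub>C res z x"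
  by (rule res_eqI) (auto simp: res_in_D scaleC_in_D A_scaleC A_res scaleC.diff_right scaleC_scaleC mult.commute)

lemma T_res: "regular z \<Longrightarrow> s \<ge> 0 \<Longrightarrow> T s (res z x) = res z (T s x)"
proof -
  assume z: "regular z" and s: "s \<ge> 0"
  interpret bounded_linear "T s" by (rule linear_T[OF s])
  show ?thesis
    by (rule sym, rule res_eqI)
      (auto simp: z s res_in_D T_in_D A_T A_res T_scaleC[OF s, symmetric] diff)
qed

text \<open>Integrating by parts along the orbit of \<open>res z0 x\<close>, which stays in the domain, expresses the truncated Laplace
  transform \<open>y\<close> of the orbit of \<open>x\<close> as a value of \<open>res z0\<close>.\<close>

lemma integral_orbit_in_D:
  fixes z :: complex and x :: 'a
  assumes z0: "regular z0" and L: "L \<ge> 0"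
  defines "y \<equiv> integral {0..L} (\<lambda>s. exp (- (z * of_real s)) *\<^sub>C T s x)"
  shows "y \<in> D" "z *\<^sub>C y + A y = x - exp (- (z * of_real L)) *\<^sub>C T L x"
proof -
  let ?e = "\<lambda>s::real. exp (- (z * of_real s))"
  interpret R: bounded_linear "res z0" by (rule bounded_linear_res[OF z0])
  have cont: "continuous_on {0..L} ?e" by (intro continuous_intros)
  have int: "(\<lambda>s. ?e s *\<^sub>C T s x) integrable_on {0..L}" for x
    by (intro integrable_continuous_interval scaleC.continuous_on cont continuous_on_T) auto
  define w where "w = res z0 x"
  have w: "w \<in> D" "A w = x - z0 *\<^sub>C w" using res_in_D[OF z0] A_res[OF z0] by (auto simp: w_def)
  have "res z0 y = integral {0..L} (\<lambda>s. res z0 (?e s *\<^sub>C T s x))"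
    using integral_linear[OF int bounded_linear_res[OF z0]] by (simp add: y_def o_def)
  also have "\<dots> = integral {0..L} (\<lambda>s. ?e s *\<^sub>C T s w)"
    by (rule integral_cong) (simp add: res_scaleC z0 T_res w_def)
  finally have Ry: "res z0 y = integral {0..L} (\<lambda>s. ?e s *\<^sub>C T s w)" .
  have "integral {0..L} (\<lambda>s. ?e s *\<^sub>C T s (A w))
      = integral {0..L} (\<lambda>s. (- z * ?e s) *\<^sub>C T s w) - (?e L *\<^sub>C T L w - ?e 0 *\<^sub>C w)"
  proof (rule integral_by_parts[OF L _ _ w(1)])
    fix s
    show "(?e has_vector_derivative (- z * ?e s)) (at s)"
      by (rule derivative_eq_intros has_vector_derivative_real_field refl | simp)+
  qed (intro continuous_intros)
  also have "integral {0..L} (\<lambda>s. (- z * ?e s) *\<^sub>C T s w) = - z *\<^sub>C res z0 y"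
    using integral_scaleC[OF int, of "- z" w] by (simp only: Ry scaleC_scaleC)
  also have "integral {0..L} (\<lambda>s. ?e s *\<^sub>C T s (A w)) = y - z0 *\<^sub>C res z0 y"
  proof -
    have "integral {0..L} (\<lambda>s. ?e s *\<^sub>C T s (A w))
        = integral {0..L} (\<lambda>s. ?e s *\<^sub>C T s x - z0 *\<^sub>C (?e s *\<^sub>C T s w))"
    proof (rule integral_cong)
      fix s assume "s \<in> {0..L}"
      then have s: "s \<ge> 0" by simp
      interpret bounded_linear "T s" by (rule linear_T[OF s])
      show "?e s *\<^sub>C T s (A w) = ?e s *\<^sub>C T s x - z0 *\<^sub>C (?e s *\<^sub>C T s w)"
        by (simp add: w(2) diff T_scaleC s scaleC.diff_right scaleC_scaleC mult.commute)
    qed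
    also have "\<dots> = y - z0 *\<^sub>C res z0 y"
      by (subst integral_diff) (simp_all add: int integrable_scaleC integral_scaleC Ry[symmetric] y_def)
    finally show ?thesis .
  qed
  finally have eq: "y = (z0 - z) *\<^sub>C res z0 y + w - ?e L *\<^sub>C T L w"
    by (simp add: scaleC.diff_left scaleC.minus_left algebra_simps)
  define v where "v = x - ?e L *\<^sub>C T L x + (z0 - z) *\<^sub>C y"
  have "y = res z0 v"
    unfolding v_def R.add R.diff res_scaleC[OF z0] T_res[OF z0 L, symmetric]
    by (subst eq) (simp add: w_def algebra_simps)
  then have "y \<in> D" "A y = v - z0 *\<^sub>C y"
    using res_in_D[OF z0] A_res[OF z0] by auto
  then show "y \<in> D" "z *\<^sub>C y + A y = x - exp (- (z * of_real L)) *\<^sub>C T L x"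
    by (auto simp: v_def scaleC.diff_left)
qed

lemma norm_exp_orbit_le:
  assumes "s \<ge> 0"
  shows "norm (exp (- (z * of_real s)) *\<^sub>C T s x) \<le> exp (- (Re z * s)) * (K * norm x)"
  unfolding norm_scaleC using bound[OF assms, of x] by (simp add: norm_exp_eq_Re)

text \<open>An element of the domain is the Laplace transform of the orbit of \<open>z y + A y\<close>, up to a remainder that vanishes as
  the interval grows.\<close>

lemma norm_le_resolvent:
  assumes z: "Re z > 0" and y: "y \<in> D"
  shows "norm y \<le> K / Re z * norm (z *\<^sub>C y + A y)"
proof -
  let ?e = "\<lambda>s::real. exp (- (z * of_real s))" and ?v = "z *\<^sub>C y + A y"
  have est: "norm y \<le> K / Re z * norm ?v + exp (- (Re z * L)) * (K * norm y)" if L: "L \<ge> 0" for L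
  proof -
    have cont: "continuous_on {0..L} ?e" by (intro continuous_intros)
    have int: "(\<lambda>s. ?e s *\<^sub>C T s x) integrable_on {0..L}" for x
      by (intro integrable_continuous_interval scaleC.continuous_on cont continuous_on_T) auto
    have parts: "integral {0..L} (\<lambda>s. ?e s *\<^sub>C T s (A y))
        = integral {0..L} (\<lambda>s. (- z * ?e s) *\<^sub>C T s y) - (?e L *\<^sub>C T L y - ?e 0 *\<^sub>C y)"
    proof (rule integral_by_parts[OF L _ _ y])
      fix s
      show "(?e has_vector_derivative (- z * ?e s)) (at s)"
        by (rule derivative_eq_intros has_vector_derivative_real_field refl | simp)+
    qed (intro continuous_intros)
    have "integral {0..L} (\<lambda>s. ?e s *\<^sub>C T s ?v)
        = integral {0..L} (\<lambda>s. ?e s *\<^sub>C T s (A y) - (- z * ?e s) *\<^sub>C T s y)"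
    proof (rule integral_cong)
      fix s assume "s \<in> {0..L}"
      then have s: "s \<ge> 0" by simp
      interpret bounded_linear "T s" by (rule linear_T[OF s])
      show "?e s *\<^sub>C T s ?v = ?e s *\<^sub>C T s (A y) - (- z * ?e s) *\<^sub>C T s y"
        by (simp add: add T_scaleC s scaleC.add_right scaleC.minus_left scaleC_scaleC mult.commute)
    qed
    also have "\<dots> = integral {0..L} (\<lambda>s. ?e s *\<^sub>C T s (A y)) - integral {0..L} (\<lambda>s. (- z * ?e s) *\<^sub>C T s y)"
      by (intro integral_diff int integrable_continuous_interval scaleC.continuous_on continuous_on_T
        continuous_intros) auto
    finally have "y = integral {0..L} (\<lambda>s. ?e s *\<^sub>C T s ?v) + ?e L *\<^sub>C T L y"
      using parts by simp
    then have "norm y \<le> norm (integral {0..L} (\<lambda>s. ?e s *\<^sub>C T s ?v)) + norm (?e L *\<^sub>C T L y)"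
      by (metis norm_triangle_ineq)
    also have "norm (integral {0..L} (\<lambda>s. ?e s *\<^sub>C T s ?v))
        \<le> integral {0..L} (\<lambda>s. exp (- (Re z * s)) * (K * norm ?v))"
      by (intro integral_norm_bound_integral int integrable_continuous_interval continuous_intros)
        (auto intro: norm_exp_orbit_le)
    also have "integral {0..L} (\<lambda>s. exp (- (Re z * s)) * (K * norm ?v))
        \<le> 1 / Re z * (K * norm ?v)"
    proof -
      have "((\<lambda>s. exp (- (Re z * s))) has_integral
          - exp (- (Re z * L)) / Re z - - exp (- (Re z * 0)) / Re z) {0..L}"
      proof (rule fundamental_theorem_of_calculus[OF L])
        show "((\<lambda>s. - exp (- (Re z * s)) / Re z) has_vector_derivative exp (- (Re z * s)))
            (at s within {0..L})" for s
          unfolding has_real_derivative_iff_has_vector_derivative[symmetric]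
          by (rule derivative_eq_intros refl | use z in force)+
      qed
      then have "integral {0..L} (\<lambda>s. exp (- (Re z * s))) \<le> 1 / Re z"
        using z by (simp add: integral_unique field_simps)
      then show ?thesis
        using K_ge_1 by (simp only: integral_mult_left) (intro mult_right_mono, auto)
    qed
    also have "norm (?e L *\<^sub>C T L y) \<le> exp (- (Re z * L)) * (K * norm y)"
      by (rule norm_exp_orbit_le[OF L])
    finally show ?thesis by simp
  qed
  have "((\<lambda>L. K / Re z * norm ?v + exp (- (Re z * L)) * (K * norm y)) \<longlongrightarrow>
      K / Re z * norm ?v + 0 * (K * norm y)) at_top"
    by (intro tendsto_intros filterlim_compose[OF exp_at_bot])
      (auto simp: filterlim_uminus_at_bot intro!: filterlim_tendsto_pos_mult_at_top[OF tendsto_const z filterlim_ident])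
  then have "norm y \<le> K / Re z * norm ?v + 0 * (K * norm y)"
    by (rule tendsto_lowerbound) (rule eventually_at_top_linorderI[of 0], erule est, simp)
  then show ?thesis by simp
qed

lemma regularI:
  assumes surj: "\<And>x. \<exists>y\<in>D. z *\<^sub>C y + A y = x"
    and bd: "\<And>y. y \<in> D \<Longrightarrow> norm y \<le> N * norm (z *\<^sub>C y + A y)"
  shows "regular z"
proof -
  let ?f = "\<lambda>x. z *\<^sub>C x + A x"
  have bij: "bij_betw ?f D UNIV"
    unfolding bij_betw_def
  proof
    show "inj_on ?f D"
    proof (rule inj_onI)
      fix x y assume *: "x \<in> D" "y \<in> D" "?f x = ?f y"
      have "?f (x - y) = 0" using * by (simp add: A_diff scaleC.diff_right algebra_simps)
      then show "x = y" using bd[OF diff_in_D[OF *(1,2)]] by simp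
    qed
    have "x \<in> ?f ` D" for x
    proof -
      from surj obtain y where "y \<in> D" "?f y = x" by blast
      then show ?thesis by (auto intro!: rev_image_eqI)
    qed
    then show "?f ` D = UNIV" by auto
  qed
  have "x \<in> ?f ` D" for x using bij by (simp add: bij_betw_def)
  then have D: "res z x \<in> D" and f: "?f (res z x) = x" for x
    unfolding res_def by (rule inv_into_into, rule f_inv_into_f[where f = ?f])
  have eqI: "res z x = y" if "y \<in> D" "?f y = x" for x y
    using bij that inv_into_f_f[of ?f D y] unfolding res_def bij_betw_def by auto
  have "bounded_linear (res z)"
  proof (rule bounded_linear_intro[where K = N])
    fix x y
    show "res z (x + y) = res z x + res z y"
    proof (rule eqI)
      have "?f (res z x + res z y) = ?f (res z x) + ?f (res z y)"
        by (simp add: A_add D scaleC.add_right)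
      then show "?f (res z x + res z y) = x + y" by (simp only: f)
    qed (simp add: D add_in_D)
    show "res z (r *\<^sub>R x) = r *\<^sub>R res z x" for r
    proof (rule eqI)
      show "?f (r *\<^sub>R res z x) = r *\<^sub>R x"
      proof -
        have "?f (r *\<^sub>R res z x) = r *\<^sub>R ?f (res z x)"
          using A_scaleC[OF D, of "of_real r" x]
          by (simp add: scaleC_of_real scaleC_scaleR scaleR_add_right)
        then show ?thesis by (simp only: f)
      qed
      show "r *\<^sub>R res z x \<in> D"
        using scaleC_in_D[OF D, of "of_real r" x] by (simp add: scaleC_of_real)
    qed
    show "norm (res z x) \<le> norm x * N" using bd[OF D, of x] f[of x] by (simp add: mult.commute)
  qed
  with bij show ?thesis by (simp add: regular_def)
qed

lemma regular_uminus_resolvent_set: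
  assumes z: "z \<in> resolvent_set D A"
  shows "regular (- z)"
proof -
  let ?f = "\<lambda>x. z *\<^sub>C x - A x" and ?g = "inv_into D (\<lambda>x. z *\<^sub>C x - A x)"
  have bij: "bij_betw ?f D UNIV" and bl: "bounded_linear ?g"
    using z by (auto simp: resolvent_set_def bounded_clinear_def)
  have neg: "(- z) *\<^sub>C y + A y = - ?f y" for y by (simp add: scaleC.minus_left)
  show ?thesis
  proof (rule regularI)
    fix x
    have "- x \<in> ?f ` D" using bij by (simp add: bij_betw_def)
    then obtain y where y: "y \<in> D" "- x = ?f y" by blast
    have "(- z) *\<^sub>C y + A y = x" unfolding neg y(2)[symmetric] by simp
    with y(1) show "\<exists>y\<in>D. (- z) *\<^sub>C y + A y = x" by blast
  next
    fix y assume y: "y \<in> D"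
    have "?g (?f y) = y" using bij y inv_into_f_f[of ?f D y] by (simp add: bij_betw_def)
    then have "norm y \<le> onorm ?g * norm (?f y)" using onorm[OF bl, of "?f y"] by simp
    then show "norm y \<le> onorm ?g * norm ((- z) *\<^sub>C y + A y)" by (simp add: neg norm_minus_commute)
  qed
qed

text \<open>For large \<open>L\<close> the operator \<open>exp (- z L) T(L)\<close> is a contraction. Hence every \<open>x\<close> has the form
  \<open>v - exp (- z L) T(L) v\<close>, and the truncated Laplace transform of the orbit of \<open>v\<close> is a preimage of \<open>x\<close>.\<close>

lemma regular_right_half_plane:
  assumes z0: "regular z0" and z: "Re z > 0"
  shows "regular z"
proof (rule regularI)
  fix x
  have "((\<lambda>L. exp (- (Re z * L)) * K) \<longlongrightarrow> 0 * K) at_top"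
    by (intro tendsto_intros filterlim_compose[OF exp_at_bot])
      (auto simp: filterlim_uminus_at_bot intro!: filterlim_tendsto_pos_mult_at_top[OF tendsto_const z filterlim_ident])
  from order_tendstoD(2)[OF this, of "1/2"] have "\<forall>\<^sub>F L in at_top. exp (- (Re z * L)) * K < 1 / 2"
    by simp
  then have "\<forall>\<^sub>F L in at_top. exp (- (Re z * L)) * K < 1 / 2 \<and> L \<ge> 0"
    using eventually_ge_at_top[of 0] by eventually_elim auto
  then obtain L where L: "exp (- (Re z * L)) * K < 1 / 2" "L \<ge> 0"
    using eventually_happens'[OF trivial_limit_at_top_linorder] by blast
  let ?e = "exp (- (z * of_real L))"
  interpret bounded_linear "T L" by (rule linear_T[OF L(2)])
  have "\<exists>!v. x + ?e *\<^sub>C T L v = v"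
  proof (rule banach_fix_type[of "1/2"], simp, simp, intro allI)
    fix v w
    have "dist (x + ?e *\<^sub>C T L v) (x + ?e *\<^sub>C T L w) = norm (?e *\<^sub>C T L (v - w))"
      by (simp add: dist_norm diff scaleC.diff_right)
    also have "\<dots> \<le> exp (- (Re z * L)) * (K * norm (v - w))"
      by (rule norm_exp_orbit_le[OF L(2)])
    also have "\<dots> = (exp (- (Re z * L)) * K) * norm (v - w)" by simp
    also have "\<dots> \<le> 1 / 2 * dist v w"
      unfolding dist_norm using L by (intro mult_right_mono) auto
    finally show "dist (x + ?e *\<^sub>C T L v) (x + ?e *\<^sub>C T L w) \<le> 1 / 2 * dist v w" .
  qed
  then obtain v where v: "x + ?e *\<^sub>C T L v = v" by blast
  have "v - ?e *\<^sub>C T L v = x" unfolding diff_eq_eq by (rule v[symmetric])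
  with integral_orbit_in_D[OF z0 L(2), of z v] show "\<exists>y\<in>D. z *\<^sub>C y + A y = x" by auto
qed (rule norm_le_resolvent[OF z])

text \<open>Means of an orbit over short intervals lie in the domain and converge to the initial value.\<close>

lemma closure_D:
  assumes z0: "regular z0"
  shows "closure D = UNIV"
proof -
  have "x \<in> closure D" for x
  proof -
    let ?y = "\<lambda>h. integral {0..h} (\<lambda>s. T s x)"
    have "(?y has_vector_derivative T 0 x) (at 0 within {0..1})"
      by (rule integral_has_vector_derivative) (auto intro: continuous_on_T)
    then have deriv: "\<forall>e>0. \<exists>d>0. \<forall>h\<in>{0..1}. \<bar>h\<bar> < d \<longrightarrow> norm (?y h - h *\<^sub>R x) \<le> e * \<bar>h\<bar>"
      by (simp add: has_vector_derivative_def has_derivative_within_alt)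
    show ?thesis
      unfolding closure_approachable
    proof (intro allI impI)
      fix e :: real assume "e > 0"
      with deriv[rule_format, of "e / 2"] obtain d where d: "d > 0"
        "\<And>h. h \<in> {0..1} \<Longrightarrow> \<bar>h\<bar> < d \<Longrightarrow> norm (?y h - h *\<^sub>R x) \<le> e / 2 * \<bar>h\<bar>" by auto
      define h where "h = min (d / 2) 1"
      have h: "0 < h" "h \<le> 1" "h < d" using d(1) by (auto simp: h_def min_def)
      have "?y h \<in> D" using integral_orbit_in_D(1)[OF z0, of h 0 x] h by simp
      then have "?y h /\<^sub>R h \<in> D"
        using scaleC_in_D[of "?y h" "of_real (inverse h)"] by (simp only: scaleC_of_real)
      moreover have "dist (?y h /\<^sub>R h) x < e"
      proof -
        have "?y h /\<^sub>R h - x = (?y h - h *\<^sub>R x) /\<^sub>R h" using h by (simp add: scaleR_diff_right)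
        then have "dist (?y h /\<^sub>R h) x = norm (?y h - h *\<^sub>R x) / h"
          using h by (simp add: dist_norm divide_inverse mult.commute)
        also have "\<dots> \<le> e / 2" using d(2)[of h] h by (simp add: field_simps)
        finally show ?thesis using \<open>e > 0\<close> by simp
      qed
      ultimately show "\<exists>y\<in>D. dist y x < e" by blast
    qed
  qed
  then show ?thesis by auto
qed

section \<open>Decay of orbits from a resolvent bound\<close>

text \<open>The functions \<open>f\<close> and \<open>g\<close> below are the truncated orbits of \<open>B x\<close> and \<open>x\<close>, where \<open>B v = v - res 1 v\<close>, damped by
  \<open>exp (- (s / t))\<close> and with the weights \<open>\<phi>\<close> and \<open>\<phi>'\<close>. The weight \<open>\<phi>'\<close> is of size \<open>1 / t\<close>, which is the gain in
  the conclusion. For \<open>x\<close> in the domain \<open>f\<close> is Lipschitz, as the Fourier comparison requires.\<close>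

lemma orbit_decay_on_domain:
  assumes one: "regular 1" and t: "t > 0" and reg: "\<And>\<tau>. regular (Complex (1 / t) \<tau>)" and q: "q \<ge> 0"
    and le: "\<And>\<tau> v. norm (res (Complex (1 / t) \<tau>) (v - res 1 v)) \<le> q * norm v"
    and x: "x \<in> D"
  shows "norm (T t (x - res 1 x)) \<le> 16 / 3 * exp 1 * K\<^sup>2 * q / t * norm x"
proof -
  define b where "b = x - res 1 x"
  have b: "b \<in> D" using x res_in_D[OF one] by (simp add: b_def diff_in_D)
  define L where "L = 2 * t"
  have L: "L > 0" "L \<ge> 0" using t by (auto simp: L_def)
  define \<phi> where "\<phi> s = s * (L - s) / t\<^sup>2" for s :: real
  define \<phi>' where "\<phi>' s = (L - 2 * s) / t\<^sup>2" for s :: real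
  have d\<phi>: "(\<phi> has_real_derivative \<phi>' s) (at s)" for s
    unfolding \<phi>_def \<phi>'_def by (rule DERIV_cdivide) (auto intro!: derivative_eq_intros)
  have c\<phi>: "continuous_on S \<phi>" "continuous_on S \<phi>'" for S
    unfolding \<phi>_def \<phi>'_def using t by (auto intro!: continuous_intros)
  have \<phi>0: "\<phi> 0 = 0" "\<phi> L = 0" by (auto simp: \<phi>_def)
  define f where "f s = (\<phi> s * exp (- (s / t))) *\<^sub>R T s b" for s
  define g where "g s = (\<phi>' s * exp (- (s / t))) *\<^sub>R T s x" for s
  have cf: "continuous_on {0..L} f" and cg: "continuous_on {0..L} g"
    unfolding f_def g_def using t by (auto intro!: continuous_intros c\<phi> continuous_on_T)
  obtain C where C: "\<And>s u. s \<in> {0..L} \<Longrightarrow> u \<in> {0..L} \<Longrightarrow> norm (f s - f u) \<le> C * \<bar>s - u\<bar>"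
  proof (rule C1_imp_lipschitz)
    let ?f' = "\<lambda>s. (\<phi> s * exp (- (s / t))) *\<^sub>R (- T s (A b))
        + (\<phi>' s * exp (- (s / t)) - \<phi> s * exp (- (s / t)) / t) *\<^sub>R T s b"
    show "(f has_vector_derivative ?f' s) (at s within {0..L})" if "s \<in> {0..L}" for s
      unfolding f_def
    proof (rule has_vector_derivative_scaleR)
      show "((\<lambda>s. \<phi> s * exp (- (s / t))) has_real_derivative
          (\<phi>' s * exp (- (s / t)) - \<phi> s * exp (- (s / t)) / t)) (at s within {0..L})"
        by (rule derivative_eq_intros DERIV_subset[OF d\<phi>] refl | use t in \<open>force simp: field_simps\<close>)+
      show "((\<lambda>s. T s b) has_vector_derivative - T s (A b)) (at s within {0..L})"
        using orbit_has_vector_derivative[OF b, of s] that by (auto intro: has_vector_derivative_within_subset)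
    qed
    show "continuous_on {0..L} ?f'"
      using t by (auto intro!: continuous_intros c\<phi> continuous_on_T)
  qed blast
  \<comment> \<open>Integrating by parts against \<open>w = res z b\<close> transfers the weight derivative; the boundary terms vanish because
      \<open>\<phi>\<close> does.\<close>
  have coeff: "norm (fourier_coeff L f n) \<le> q * norm (fourier_coeff L g n)" for n
  proof -
    define \<tau> where "\<tau> = 2 * pi / L * of_int n"
    define z where "z = Complex (1 / t) \<tau>"
    have z: "regular z" by (simp add: z_def reg)
    let ?e = "\<lambda>s::real. exp (- (z * of_real s))"
    have e: "?e s = of_real (exp (- (s / t))) * cis (- (\<tau> * s))" for s
      by (simp add: exp_eq_polar z_def)
    define w where "w = res z b"
    have w: "w \<in> D" "A w = b - z *\<^sub>C w" using z by (auto simp: w_def res_in_D A_res)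
    define c where "c s = of_real (\<phi> s) * ?e s" for s
    define c' where "c' s = of_real (\<phi>' s) * ?e s - z * c s" for s
    have dc: "(c has_vector_derivative c' s) (at s)" for s
    proof -
      have d1: "((\<lambda>s. of_real (\<phi> s)) has_vector_derivative (of_real (\<phi>' s) :: complex)) (at s)"
        using d\<phi> by (intro has_vector_derivative_of_real) (simp add: has_real_derivative_iff_has_vector_derivative)
      have d2: "(?e has_vector_derivative (- z * ?e s)) (at s)"
        by (rule derivative_eq_intros has_vector_derivative_real_field refl | simp)+
      show ?thesis
        unfolding c_def c'_def
        by (rule has_vector_derivative_eq_rhs[OF has_vector_derivative_mult[OF d1 d2]]) simp
    qed
    have ce: "continuous_on {0..L} (\<lambda>s. of_real (\<phi>' s) * ?e s)"
      by (intro continuous_intros c\<phi>)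
    have cc: "continuous_on {0..L} c" "continuous_on {0..L} c'"
      unfolding c_def c'_def by (intro continuous_intros c\<phi>)+
    have int: "(\<lambda>s. k s *\<^sub>C T s v) integrable_on {0..L}" if "continuous_on {0..L} k" for k v
      by (intro integrable_continuous_interval scaleC.continuous_on that continuous_on_T) auto
    have f_eq: "fourier_coeff L f n = integral {0..L} (\<lambda>s. c s *\<^sub>C T s b)"
      unfolding fourier_coeff_def f_def c_def e \<tau>_def[symmetric]
      by (intro integral_cong) (simp add: scaleC_of_real[symmetric] scaleC_scaleC mult_ac)
    have g_eq: "fourier_coeff L g n = integral {0..L} (\<lambda>s. (of_real (\<phi>' s) * ?e s) *\<^sub>C T s x)"
      unfolding fourier_coeff_def g_def e \<tau>_def[symmetric]
      by (intro integral_cong) (simp add: scaleC_of_real[symmetric] scaleC_scaleC mult_ac)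
    have "integral {0..L} (\<lambda>s. c s *\<^sub>C T s b)
        = integral {0..L} (\<lambda>s. c s *\<^sub>C T s (A w) + z *\<^sub>C (c s *\<^sub>C T s w))"
    proof (rule integral_cong)
      fix s assume "s \<in> {0..L}"
      then have s: "s \<ge> 0" by simp
      interpret bounded_linear "T s" by (rule linear_T[OF s])
      show "c s *\<^sub>C T s b = c s *\<^sub>C T s (A w) + z *\<^sub>C (c s *\<^sub>C T s w)"
        by (simp add: w(2) diff T_scaleC s scaleC.diff_right scaleC_scaleC mult.commute)
    qed
    also have "\<dots> = integral {0..L} (\<lambda>s. c s *\<^sub>C T s (A w)) + z *\<^sub>C integral {0..L} (\<lambda>s. c s *\<^sub>C T s w)"
      by (subst integral_add) (simp_all add: int cc integrable_scaleC integral_scaleC)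
    also have "integral {0..L} (\<lambda>s. c s *\<^sub>C T s (A w)) = integral {0..L} (\<lambda>s. c' s *\<^sub>C T s w)"
      using integral_by_parts[OF L(2) dc cc(2) w(1)] \<phi>0 by (simp add: c_def scaleC.zero_left)
    also have "integral {0..L} (\<lambda>s. c' s *\<^sub>C T s w)
        = integral {0..L} (\<lambda>s. (of_real (\<phi>' s) * ?e s) *\<^sub>C T s w - z *\<^sub>C (c s *\<^sub>C T s w))"
      by (intro integral_cong) (simp add: c'_def scaleC.diff_left scaleC_scaleC)
    also have "\<dots> = integral {0..L} (\<lambda>s. (of_real (\<phi>' s) * ?e s) *\<^sub>C T s w)
        - z *\<^sub>C integral {0..L} (\<lambda>s. c s *\<^sub>C T s w)"
      by (subst integral_diff) (simp_all add: int[OF ce] int cc integrable_scaleC integral_scaleC)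
    also have "\<dots> + z *\<^sub>C integral {0..L} (\<lambda>s. c s *\<^sub>C T s w)
        = integral {0..L} (\<lambda>s. (of_real (\<phi>' s) * ?e s) *\<^sub>C T s w)" by simp
    also have "\<dots> = integral {0..L} (\<lambda>s. res z ((of_real (\<phi>' s) * ?e s) *\<^sub>C T s x
        - res 1 ((of_real (\<phi>' s) * ?e s) *\<^sub>C T s x)))"
    proof (rule integral_cong)
      fix s assume "s \<in> {0..L}"
      then have s: "s \<ge> 0" by simp
      interpret bounded_linear "T s" by (rule linear_T[OF s])
      show "(of_real (\<phi>' s) * ?e s) *\<^sub>C T s w = res z ((of_real (\<phi>' s) * ?e s) *\<^sub>C T s x
        - res 1 ((of_real (\<phi>' s) * ?e s) *\<^sub>C T s x))"
        by (simp add: w_def b_def T_res[OF z s] T_res[OF one s] diff res_scaleC[OF z] res_scaleC[OF one]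
            scaleC.diff_right[symmetric])
    qed
    also have "\<dots> = res z (fourier_coeff L g n - res 1 (fourier_coeff L g n))"
      unfolding g_eq
      by (rule integral_linear[OF int[OF ce], of "\<lambda>v. res z (v - res 1 v)", unfolded o_def])
        (intro bounded_linear_compose[OF bounded_linear_res[OF z]] bounded_linear_sub
          bounded_linear_ident bounded_linear_res[OF one])
    finally show ?thesis
      unfolding f_eq using le[of \<tau> "fourier_coeff L g n"] by (simp add: z_def)
  qed
  have main: "integral {0..L} (\<lambda>s. (norm (f s))\<^sup>2) \<le> q\<^sup>2 * integral {0..L} (\<lambda>s. (norm (g s))\<^sup>2)"
    by (rule fourier_multiplier_bound[OF L(1) C _ cf cg coeff]) (simp_all add: f_def \<phi>0)
  \<comment> \<open>a lower bound for \<open>norm (f s)\<close> on the interval from \<open>t / 2\<close> to \<open>t\<close>, where \<open>\<phi> s \<ge> 3 / 4\<close>\<close>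
  define m where "m = 3 / 4 * exp (-1) * norm (T t b) / K"
  have m: "m \<ge> 0" using K_ge_1 by (simp add: m_def)
  have "t / 2 * m\<^sup>2 = integral {t/2..t} (\<lambda>s. m\<^sup>2)"
    using t by simp
  also have "\<dots> \<le> integral {t/2..t} (\<lambda>s. (norm (f s))\<^sup>2)"
  proof (rule integral_le)
    show "(\<lambda>s. (norm (f s))\<^sup>2) integrable_on {t/2..t}"
      by (intro integrable_continuous_interval continuous_intros continuous_on_subset[OF cf])
        (use t in \<open>auto simp: L_def\<close>)
    fix s assume s: "s \<in> {t/2..t}"
    then have s0: "s \<ge> 0" "t - s \<ge> 0" using t by auto
    have \<phi>s: "\<phi> s \<ge> 3 / 4"
    proof -
      have "3 / 4 * t\<^sup>2 \<le> (t / 2) * (t * 3 / 2)" by (simp add: power2_eq_square)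
      also have "\<dots> \<le> s * (L - s)"
      proof -
        have "0 \<le> (s - t / 2) * (t * 3 / 2 - s)" using s t by (intro mult_nonneg_nonneg) auto
        moreover have "(s - t / 2) * (t * 3 / 2 - s) = s * (L - s) - (t / 2) * (t * 3 / 2)"
          by (simp add: L_def field_simps)
        ultimately show ?thesis by linarith
      qed
      finally show ?thesis using t by (simp add: \<phi>_def pos_le_divide_eq)
    qed
    have "norm (T t b) \<le> K * norm (T s b)"
      using T_add[of "t - s" s b] bound[OF s0(2), of "T s b"] s0 by simp
    then have nT: "norm (T t b) / K \<le> norm (T s b)" using K_ge_1 by (simp add: field_simps)
    have "m = (3 / 4 * exp (-1)) * (norm (T t b) / K)" by (simp add: m_def)
    also have "\<dots> \<le> (\<phi> s * exp (- (s / t))) * norm (T s b)"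
      using s t \<phi>s nT K_ge_1 by (intro mult_mono) auto
    also have "\<dots> = norm (f s)" using \<phi>s by (simp add: f_def)
    finally show "m\<^sup>2 \<le> (norm (f s))\<^sup>2" using m by (intro power_mono)
  qed (auto intro: integrable_const_ivl)
  also have "\<dots> \<le> integral {0..L} (\<lambda>s. (norm (f s))\<^sup>2)"
    by (rule integral_subset_le)
      (use t in \<open>auto intro!: integrable_continuous_interval continuous_intros continuous_on_subset[OF cf] simp: L_def\<close>)
  also note main
  also have "integral {0..L} (\<lambda>s. (norm (g s))\<^sup>2) \<le> integral {0..L} (\<lambda>s. (2 / t * (K * norm x))\<^sup>2)"
  proof (rule integral_le)
    show "(\<lambda>s. (norm (g s))\<^sup>2) integrable_on {0..L}"
      by (intro integrable_continuous_interval continuous_intros cg)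
    fix s assume s: "s \<in> {0..L}"
    have "\<bar>\<phi>' s\<bar> \<le> 2 / t"
      using s t by (auto simp: \<phi>'_def L_def field_simps power2_eq_square abs_le_iff)
    then have "norm (g s) \<le> (2 / t * 1) * (K * norm x)"
      unfolding g_def norm_scaleR abs_mult using s t bound[of s x] by (intro mult_mono) auto
    then show "(norm (g s))\<^sup>2 \<le> (2 / t * (K * norm x))\<^sup>2" by (intro power_mono) auto
  qed (auto intro: integrable_const_ivl)
  also have "\<dots> = 8 / t * (K * norm x)\<^sup>2"
    using L(2) t by (simp add: L_def power_mult_distrib power_divide power2_eq_square field_simps)
  finally have "t / 2 * m\<^sup>2 \<le> q\<^sup>2 * (8 / t * (K * norm x)\<^sup>2)"
    by (simp add: mult_left_mono)
  then have "m\<^sup>2 \<le> (4 * q * K * norm x / t)\<^sup>2"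
    using t by (simp add: field_simps power2_eq_square)
  then have "m \<le> 4 * q * K * norm x / t"
    by (rule power2_le_imp_le) (use q K_ge_1 t in simp)
  then have "m * (K * (4 / 3) * exp 1) \<le> 4 * q * K * norm x / t * (K * (4 / 3) * exp 1)"
    using K_ge_1 by (intro mult_right_mono) auto
  also have "m * (K * (4 / 3) * exp 1) = norm (T t b)"
    using K_ge_1 by (simp add: m_def exp_minus)
  also have "4 * q * K * norm x / t * (K * (4 / 3) * exp 1) = 16 / 3 * exp 1 * K\<^sup>2 * q / t * norm x"
    by (simp add: power2_eq_square mult_ac)
  finally show ?thesis by (simp add: b_def)
qed

lemma orbit_decay:
  assumes one: "regular 1" and t: "t > 0" and reg: "\<And>\<tau>. regular (Complex (1 / t) \<tau>)" and q: "q \<ge> 0"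
    and le: "\<And>\<tau> v. norm (res (Complex (1 / t) \<tau>) (v - res 1 v)) \<le> q * norm v"
  shows "norm (T t (x - res 1 x)) \<le> 16 / 3 * exp 1 * K\<^sup>2 * q / t * norm x"
proof -
  have lin: "bounded_linear (\<lambda>x. T t (x - res 1 x))"
    using t by (intro bounded_linear_compose[OF linear_T] bounded_linear_sub bounded_linear_ident
        bounded_linear_res[OF one]) simp
  have "closed {x. norm (T t (x - res 1 x)) \<le> 16 / 3 * exp 1 * K\<^sup>2 * q / t * norm x}"
    by (intro closed_Collect_le continuous_intros bounded_linear.continuous_on[OF lin])
  then have "closure D \<subseteq> {x. norm (T t (x - res 1 x)) \<le> 16 / 3 * exp 1 * K\<^sup>2 * q / t * norm x}"
    using orbit_decay_on_domain[OF assms] by (intro closure_minimal) auto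
  then show ?thesis using closure_D[OF one] by auto
qed

section \<open>Resolvent estimates near the imaginary axis\<close>

lemma norm_res_le:
  assumes "regular z" "Re z > 0"
  shows "norm (res z x) \<le> K / Re z * norm x"
  using norm_le_resolvent[OF assms(2) res_in_D[OF assms(1)], of x] res_right[OF assms(1)] by simp

text \<open>With \<open>y = res (\<sigma> + i \<tau>) x\<close> one has \<open>y = res (i \<tau>) (x - \<sigma> y)\<close>, and \<open>\<sigma> norm y \<le> K norm x\<close>.\<close>

lemma norm_res_shift_le:
  assumes i: "regular (\<i> * of_real \<tau>)" and z: "regular (Complex \<sigma> \<tau>)" and \<sigma>: "\<sigma> > 0"
    and N: "\<And>x. norm (res (\<i> * of_real \<tau>) x) \<le> N * norm x" and N0: "N \<ge> 0"
  shows "norm (res (Complex \<sigma> \<tau>) x) \<le> (1 + K) * N * norm x"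
proof -
  let ?y = "res (Complex \<sigma> \<tau>) x"
  have "Complex \<sigma> \<tau> = of_real \<sigma> + \<i> * of_real \<tau>" by (simp add: complex_eq_iff)
  then have "(\<i> * of_real \<tau>) *\<^sub>C ?y + A ?y = x - \<sigma> *\<^sub>R ?y"
    using res_right[OF z, of x] by (simp add: scaleC_add_left scaleC_of_real algebra_simps)
  then have "?y = res (\<i> * of_real \<tau>) (x - \<sigma> *\<^sub>R ?y)"
    using res_eqI[OF i res_in_D[OF z]] by metis
  then have "norm ?y \<le> N * norm (x - \<sigma> *\<^sub>R ?y)" by (metis N)
  also have "\<dots> \<le> N * ((1 + K) * norm x)"
  proof (intro mult_left_mono N0)
    have "norm (x - \<sigma> *\<^sub>R ?y) \<le> norm x + \<sigma> * norm ?y"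
      using norm_triangle_ineq4[of x "\<sigma> *\<^sub>R ?y"] \<sigma> by simp
    also have "\<sigma> * norm ?y \<le> K * norm x"
      using norm_res_le[OF z, of x] \<sigma> by (simp add: field_simps)
    finally show "norm (x - \<sigma> *\<^sub>R ?y) \<le> (1 + K) * norm x" by (simp add: algebra_simps)
  qed
  finally show ?thesis by (simp add: mult_ac)
qed

lemma res_complement:
  assumes z: "regular z" and one: "regular 1"
  shows "res z (x - res 1 x) = res 1 x - z *\<^sub>C res z (res 1 x)"
proof (rule res_eqI[OF z])
  let ?p = "res 1 x"
  have p: "?p \<in> D" "A ?p = x - ?p" using res_in_D[OF one] A_res[OF one] by auto
  show "?p - z *\<^sub>C res z ?p \<in> D" using p res_in_D[OF z] by (intro diff_in_D scaleC_in_D) auto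
  have "A (?p - z *\<^sub>C res z ?p) = x - ?p - z *\<^sub>C (?p - z *\<^sub>C res z ?p)"
    by (simp add: A_diff p scaleC_in_D res_in_D[OF z] A_scaleC A_res[OF z])
  then show "z *\<^sub>C (?p - z *\<^sub>C res z ?p) + A (?p - z *\<^sub>C res z ?p) = x - ?p" by simp
qed

text \<open>If \<open>y = res w x\<close> then \<open>y = res z (x - (w - z) y)\<close>; for \<open>w\<close> close to \<open>z\<close> the term with \<open>y\<close> is absorbed.\<close>

lemma res_locally_bounded:
  assumes z: "regular z"
  obtains N d where "d > 0" "N \<ge> 0"
    "\<And>w x. regular w \<Longrightarrow> cmod (w - z) < d \<Longrightarrow> norm (res w x) \<le> N * norm x"
proof -
  define N where "N = onorm (res z)"
  have N: "norm (res z x) \<le> N * norm x" "N \<ge> 0" for x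
    using onorm[OF bounded_linear_res[OF z]] onorm_pos_le[OF bounded_linear_res[OF z]] by (auto simp: N_def)
  show ?thesis
  proof (rule that[of "1 / (2 * (N + 1))" "2 * N"])
    fix w x assume w: "regular w" "cmod (w - z) < 1 / (2 * (N + 1))"
    let ?y = "res w x"
    have "z *\<^sub>C ?y + A ?y = x - (w - z) *\<^sub>C ?y"
      using res_right[OF w(1), of x] by (simp add: scaleC.diff_left algebra_simps)
    then have "?y = res z (x - (w - z) *\<^sub>C ?y)"
      using res_eqI[OF z res_in_D[OF w(1)]] by metis
    then have "norm ?y \<le> N * norm (x - (w - z) *\<^sub>C ?y)" by (metis N(1))
    also have "\<dots> \<le> N * (norm x + cmod (w - z) * norm ?y)"
      using norm_triangle_ineq4[of x "(w - z) *\<^sub>C ?y"] N(2)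
      by (intro mult_left_mono) (auto simp: norm_scaleC)
    also have "\<dots> = N * norm x + (N * cmod (w - z)) * norm ?y" by (simp add: algebra_simps)
    also have "\<dots> \<le> N * norm x + 1 / 2 * norm ?y"
    proof -
      have "N * cmod (w - z) \<le> N * (1 / (2 * (N + 1)))" using w N(2) by (intro mult_left_mono) auto
      also have "\<dots> \<le> 1 / 2" using N(2) by (simp add: field_simps)
      finally show ?thesis by (intro add_left_mono mult_right_mono) auto
    qed
    finally show "norm ?y \<le> 2 * N * norm x" by simp
  qed (use N(2) in auto)
qed

lemma res_bounded_on_compact:
  assumes S: "compact S" and reg: "\<And>z. z \<in> S \<Longrightarrow> regular z"
  obtains N where "\<And>z x. z \<in> S \<Longrightarrow> norm (res z x) \<le> N * norm x"
proof -
  have "\<forall>z. \<exists>d N. z \<in> S \<longrightarrow> d > 0 \<and> (\<forall>w x. w \<in> S \<longrightarrow> w \<in> ball z d \<longrightarrow> norm (res w x) \<le> N * norm x)"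
  proof
    fix z
    show "\<exists>d N. z \<in> S \<longrightarrow> d > 0 \<and> (\<forall>w x. w \<in> S \<longrightarrow> w \<in> ball z d \<longrightarrow> norm (res w x) \<le> N * norm x)"
    proof (cases "z \<in> S")
      case True
      obtain N d where "d > 0" "N \<ge> 0"
        "\<And>w x. regular w \<Longrightarrow> cmod (w - z) < d \<Longrightarrow> norm (res w x) \<le> N * norm x"
        using res_locally_bounded[OF reg[OF True]] by metis
      then show ?thesis
        using reg by (intro exI[of _ d] exI[of _ N]) (auto simp: dist_norm norm_minus_commute)
    qed auto
  qed
  then obtain d N where dN: "\<And>z. z \<in> S \<Longrightarrow> d z > 0"
    "\<And>z w x. z \<in> S \<Longrightarrow> w \<in> S \<Longrightarrow> w \<in> ball z (d z) \<Longrightarrow> norm (res w x) \<le> N z * norm x"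
    by metis
  have "S \<subseteq> (\<Union>z\<in>S. ball z (d z))" using dN(1) by auto
  then obtain F where F: "F \<subseteq> S" "finite F" "S \<subseteq> (\<Union>z\<in>F. ball z (d z))"
    using compactE_image[OF S, of S "\<lambda>z. ball z (d z)"] by auto
  show ?thesis
  proof (rule that[of "\<Sum>z\<in>F. \<bar>N z\<bar>"])
    fix w x assume w: "w \<in> S"
    then obtain z where z: "z \<in> F" "w \<in> ball z (d z)" using F(3) by auto
    have "norm (res w x) \<le> N z * norm x" using dN(2) z w F(1) by blast
    also have "\<dots> \<le> (\<Sum>z\<in>F. \<bar>N z\<bar>) * norm x"
      using member_le_sum[OF z(1), of "\<lambda>z. \<bar>N z\<bar>"] F(2) abs_ge_self[of "N z"]
      by (intro mult_right_mono) auto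
    finally show "norm (res w x) \<le> (\<Sum>z\<in>F. \<bar>N z\<bar>) * norm x" .
  qed
qed

text \<open>Three ranges of \<open>\<tau>\<close>: below \<open>r\<close> the half-plane bound \<open>K * t\<close> is used, between \<open>r\<close> and \<open>s\<close> the bound \<open>m\<close> on the
  axis together with \<open>decr\<close>, and beyond \<open>s\<close> the uniform bound \<open>C1\<close>. The condition
  \<open>r * t \<ge> 1\<close> makes \<open>r * t\<close> dominate the constant contributions.\<close>

lemma res_complement_bound:
  fixes m :: "real \<Rightarrow> real"
  assumes one: "regular 1" and t: "t > 0"
    and axis: "\<And>\<tau>. \<tau> \<noteq> 0 \<Longrightarrow> regular (\<i> * of_real \<tau>)"
    and reg: "regular (Complex (1 / t) \<tau>)"
    and near: "\<And>\<tau> x. \<tau> \<noteq> 0 \<Longrightarrow> \<bar>\<tau>\<bar> \<le> s \<Longrightarrow> norm (res (\<i> * of_real \<tau>) x) \<le> m \<bar>\<tau>\<bar> * norm x"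
    and far: "\<And>\<tau> x. \<bar>\<tau>\<bar> \<ge> s \<Longrightarrow> norm (res (\<i> * of_real \<tau>) x) \<le> C1 * norm x"
    and s: "s > 0" and m0: "\<And>u. u > 0 \<Longrightarrow> u \<le> s \<Longrightarrow> m u \<ge> 0" and C: "C1 \<ge> 0" "C2 \<ge> 0"
    and r: "r > 0" "r * t \<ge> 1"
    and decr: "\<And>u. r \<le> u \<Longrightarrow> u \<le> s \<Longrightarrow> u * m u \<le> C2 * (r * t)"
  shows "norm (res (Complex (1 / t) \<tau>) (v - res 1 v))
       \<le> (K * (1 + 2 * K) + K * (1 + 2 * (1 + K) * C2) + (1 + K) * C1 * (1 + K)) * (r * t) * norm v"
proof -
  let ?z = "Complex (1 / t) \<tau>" and ?p = "res 1 v"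
  let ?c1 = "K * (1 + 2 * K)" and ?c2 = "K * (1 + 2 * (1 + K) * C2)" and ?c3 = "(1 + K) * C1 * (1 + K)"
  have nn: "?c1 \<ge> 0" "?c2 \<ge> 0" "?c3 \<ge> 0" using K_ge_1 C by auto
  have rtv: "r * t * norm v \<ge> 0" using r t by simp
  have r1: "1 / t \<le> r" using r t by (simp add: field_simps)
  have p: "norm ?p \<le> K * norm v" using norm_res_le[OF one, of v] by simp
  have z: "cmod ?z \<le> 1 / t + \<bar>\<tau>\<bar>" using cmod_le[of ?z] t by simp
  have low: "norm (res ?z (v - ?p)) \<le> K * (1 + cmod ?z * B) * norm v"
    if B: "\<And>x. norm (res ?z x) \<le> B * norm x" "B \<ge> 0" for B
  proof -
    have "norm (res ?z (v - ?p)) \<le> norm ?p + cmod ?z * norm (res ?z ?p)"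
      unfolding res_complement[OF reg one]
      using norm_triangle_ineq4[of ?p "?z *\<^sub>C res ?z ?p"] by (simp add: norm_scaleC)
    also have "\<dots> \<le> norm ?p + cmod ?z * (B * norm ?p)"
      using B by (intro add_left_mono mult_left_mono) auto
    also have "\<dots> = (1 + cmod ?z * B) * norm ?p" by (simp add: algebra_simps)
    also have "\<dots> \<le> (1 + cmod ?z * B) * (K * norm v)"
      using p B by (intro mult_left_mono) auto
    finally show ?thesis by (simp add: mult_ac)
  qed
  consider "\<bar>\<tau>\<bar> \<le> r" | "r \<le> \<bar>\<tau>\<bar>" "\<bar>\<tau>\<bar> \<le> s" | "s \<le> \<bar>\<tau>\<bar>" by linarith
  then have "norm (res ?z (v - ?p)) \<le> ?c1 * (r * t * norm v)
      \<or> norm (res ?z (v - ?p)) \<le> ?c2 * (r * t * norm v)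
      \<or> norm (res ?z (v - ?p)) \<le> ?c3 * (r * t * norm v)"
  proof cases
    case 1
    have "norm (res ?z (v - ?p)) \<le> K * (1 + cmod ?z * (K * t)) * norm v"
      using norm_res_le[OF reg] t K_ge_1 by (intro low) auto
    also have "\<dots> \<le> (K * ((1 + 2 * K) * (r * t))) * norm v"
    proof (intro mult_right_mono mult_left_mono)
      have "cmod ?z * (K * t) \<le> (2 * r) * (K * t)"
        using z r1 1 K_ge_1 t by (intro mult_right_mono) auto
      then show "1 + cmod ?z * (K * t) \<le> (1 + 2 * K) * (r * t)"
        using r by (simp add: algebra_simps)
    qed (use K_ge_1 in auto)
    finally show ?thesis by (simp add: mult_ac)
  next
    case 2
    have \<tau>: "\<tau> \<noteq> 0" using 2 r by auto
    have m\<tau>: "m \<bar>\<tau>\<bar> \<ge> 0" using m0 2 r by auto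
    have B: "norm (res ?z x) \<le> (1 + K) * m \<bar>\<tau>\<bar> * norm x" for x
      using t by (intro norm_res_shift_le axis \<tau> reg near 2 m\<tau>) auto
    have "norm (res ?z (v - ?p)) \<le> K * (1 + cmod ?z * ((1 + K) * m \<bar>\<tau>\<bar>)) * norm v"
      using B m\<tau> K_ge_1 by (intro low) auto
    also have "\<dots> \<le> (K * ((1 + 2 * (1 + K) * C2) * (r * t))) * norm v"
    proof (intro mult_right_mono mult_left_mono)
      have "cmod ?z * ((1 + K) * m \<bar>\<tau>\<bar>) \<le> (2 * \<bar>\<tau>\<bar>) * ((1 + K) * m \<bar>\<tau>\<bar>)"
        using z r1 2 K_ge_1 m\<tau> by (intro mult_right_mono) auto
      also have "\<dots> = 2 * (1 + K) * (\<bar>\<tau>\<bar> * m \<bar>\<tau>\<bar>)" by simp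
      also have "\<dots> \<le> 2 * (1 + K) * (C2 * (r * t))"
        using decr 2 K_ge_1 by (intro mult_left_mono) auto
      finally show "1 + cmod ?z * ((1 + K) * m \<bar>\<tau>\<bar>) \<le> (1 + 2 * (1 + K) * C2) * (r * t)"
        using r by (simp add: algebra_simps)
    qed (use K_ge_1 in auto)
    finally show ?thesis by (simp add: mult_ac)
  next
    case 3
    have \<tau>: "\<tau> \<noteq> 0" using 3 s by auto
    have "norm (res ?z (v - ?p)) \<le> (1 + K) * C1 * norm (v - ?p)"
      using t C by (intro norm_res_shift_le axis \<tau> reg far 3) auto
    also have "\<dots> \<le> (1 + K) * C1 * ((1 + K) * norm v)"
      using p norm_triangle_ineq4[of v ?p] K_ge_1 C
      by (intro mult_left_mono) (auto simp: algebra_simps)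
    also have "\<dots> = ?c3 * (1 * norm v)" by simp
    also have "\<dots> \<le> ?c3 * (r * t * norm v)"
      using nn r by (intro mult_left_mono mult_right_mono) auto
    finally show ?thesis by simp
  qed
  moreover have "?c1 * (r * t * norm v) \<ge> 0" "?c2 * (r * t * norm v) \<ge> 0" "?c3 * (r * t * norm v) \<ge> 0"
    using nn rtv by (auto intro!: mult_nonneg_nonneg)
  ultimately have "norm (res ?z (v - ?p))
      \<le> ?c1 * (r * t * norm v) + ?c2 * (r * t * norm v) + ?c3 * (r * t * norm v)" by linarith
  then show ?thesis by (simp add: distrib_right mult.assoc)
qed

end

section \<open>The decay rate\<close>

theorem theorem7p7:
  fixes T :: "real \<Rightarrow> 'a::complex_hilbert_space \<Rightarrow> 'a"
    and D :: "'a set" and A :: "'a \<Rightarrow> 'a"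
    and \<alpha> a :: real and l :: "real \<Rightarrow> real"
  assumes "C0_semigroup T" and "bounded_semigroup T"
    and "is_generator T D (\<lambda>x. - A x)"
    and "spectrum D A \<inter> {z. Re z = 0} = {0}"
    and "\<alpha> > 1"
    and "slowly_varying a l" and "mono_on {a..} l"
    and "(\<lambda>s::real. onorm (inv_into D (\<lambda>x. (\<i> * complex_of_real s) *\<^sub>C x + A x)))
           \<in> O[at 0](\<lambda>s. 1 / (\<bar>s\<bar> powr \<alpha> * l (1 / \<bar>s\<bar>)))"
    and "(\<lambda>s::real. onorm (inv_into D (\<lambda>x. (\<i> * complex_of_real s) *\<^sub>C x + A x)))
           \<in> O[at_infinity](\<lambda>s. 1)"
  shows "(\<lambda>t. onorm (\<lambda>x. T t (A (inv_into D (\<lambda>y. y + A y) x))))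
           \<in> O[at_top](\<lambda>t. 1 / (t * l (t powr (1 / \<alpha>))) powr (1 / \<alpha>))"
proof -
  obtain M where M: "\<And>t. t \<ge> 0 \<Longrightarrow> onorm (T t) \<le> M"
    using assms(2) by (auto simp: bounded_semigroup_def)
  define K where "K = max M 1"
  interpret bounded_C0_semigroup T D A K
  proof
    fix t :: real and x assume t: "t \<ge> 0"
    then have "bounded_linear (T t)" using assms(1) by (simp add: C0_semigroup_def bounded_clinear_def)
    then have "norm (T t x) \<le> onorm (T t) * norm x" by (rule onorm)
    also have "\<dots> \<le> K * norm x" using M[OF t] by (intro mult_right_mono) (auto simp: K_def)
    finally show "norm (T t x) \<le> K * norm x" .
  qed (use assms in \<open>auto simp: K_def\<close>)
  have axis: "regular (\<i> * of_real \<tau>)" if "\<tau> \<noteq> 0" for \<tau>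
  proof -
    have "- (\<i> * of_real \<tau>) \<notin> spectrum D A"
    proof
      assume "- (\<i> * of_real \<tau>) \<in> spectrum D A"
      then have "- (\<i> * of_real \<tau>) \<in> spectrum D A \<inter> {z. Re z = 0}" by simp
      then show False using assms(4) that by simp
    qed
    then show ?thesis
      using regular_uminus_resolvent_set[of "- (\<i> * of_real \<tau>)"] by (simp add: spectrum_def)
  qed
  have right: "regular z" if "Re z > 0" for z
    using regular_right_half_plane[OF axis[of 1] that] by simp
  have one: "regular 1" by (rule right) simp
  have op: "A (inv_into D (\<lambda>y. y + A y) x) = x - res 1 x" for x
    using A_res[OF one, of x] by (simp add: res_def)
  have res_onorm: "norm (res (\<i> * of_real \<tau>) x)
      \<le> onorm (inv_into D (\<lambda>x. (\<i> * complex_of_real \<tau>) *\<^sub>C x + A x)) * norm x" if "\<tau> \<noteq> 0" for \<tau> x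
    using onorm[OF bounded_linear_res[OF axis[OF that]]] by (simp add: res_def)
  define r where "r t = 1 / (t * l (t powr (1 / \<alpha>))) powr (1 / \<alpha>)" for t
  obtain u0 C where u0: "u0 \<ge> a" "u0 \<ge> 1" and C: "C \<ge> 0"
    and rate: "\<forall>\<^sub>F t in at_top. r t > 0 \<and> r t * t \<ge> 1 \<and>
       (\<forall>u. r t \<le> u \<longrightarrow> u \<le> 1 / u0 \<longrightarrow> u * (1 / (u powr \<alpha> * l (1 / u))) \<le> C * (r t * t))"
    unfolding r_def by (rule rate_estimates[OF assms(6,7,5)])
  obtain c where c: "c > 0" "\<forall>\<^sub>F s::real in at 0.
      norm (onorm (inv_into D (\<lambda>x. (\<i> * complex_of_real s) *\<^sub>C x + A x)))
      \<le> c * norm (1 / (\<bar>s\<bar> powr \<alpha> * l (1 / \<bar>s\<bar>)))"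
    using landau_o.bigE[OF assms(8)] by blast
  from c(2) obtain d where d: "d > 0" "\<And>s. s \<noteq> 0 \<Longrightarrow> \<bar>s\<bar> < d \<Longrightarrow>
      norm (onorm (inv_into D (\<lambda>x. (\<i> * complex_of_real s) *\<^sub>C x + A x)))
      \<le> c * norm (1 / (\<bar>s\<bar> powr \<alpha> * l (1 / \<bar>s\<bar>)))"
    by (auto simp: eventually_at)
  obtain c' where "\<forall>\<^sub>F s::real in at_infinity.
      norm (onorm (inv_into D (\<lambda>x. (\<i> * complex_of_real s) *\<^sub>C x + A x))) \<le> c' * norm (1::real)"
    using landau_o.bigE[OF assms(9)] by blast
  then obtain b where b: "\<And>s. \<bar>s\<bar> \<ge> b \<Longrightarrow>
      norm (onorm (inv_into D (\<lambda>x. (\<i> * complex_of_real s) *\<^sub>C x + A x))) \<le> c'"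
    by (auto simp: eventually_at_infinity)
  define s where "s = min (d / 2) (1 / u0)"
  have s: "s > 0" "s < d" "s \<le> 1 / u0" using d(1) u0 by (auto simp: s_def min_def)
  define m where "m u = c * (1 / (u powr \<alpha> * l (1 / u)))" for u
  have l_pos: "l (1 / u) > 0" if "u > 0" "u \<le> s" for u
  proof -
    have "u \<le> 1 / u0" using that s by linarith
    then have "1 / u \<ge> u0" using that u0 by (simp add: field_simps)
    then show ?thesis using assms(6) u0 by (auto simp: slowly_varying_def)
  qed
  have m0: "m u \<ge> 0" if "u > 0" "u \<le> s" for u
    using l_pos[OF that] c(1) by (simp add: m_def)
  have near: "norm (res (\<i> * of_real \<tau>) x) \<le> m \<bar>\<tau>\<bar> * norm x" if \<tau>: "\<tau> \<noteq> 0" "\<bar>\<tau>\<bar> \<le> s" for \<tau> x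
  proof -
    have "norm (1 / (\<bar>\<tau>\<bar> powr \<alpha> * l (1 / \<bar>\<tau>\<bar>))) = 1 / (\<bar>\<tau>\<bar> powr \<alpha> * l (1 / \<bar>\<tau>\<bar>))"
      using l_pos[of "\<bar>\<tau>\<bar>"] \<tau> by (simp add: less_imp_le)
    then have "onorm (inv_into D (\<lambda>x. (\<i> * complex_of_real \<tau>) *\<^sub>C x + A x)) \<le> m \<bar>\<tau>\<bar>"
      using d(2)[OF \<tau>(1)] \<tau>(2) s(2) by (simp add: m_def abs_le_iff)
    then show ?thesis
      using res_onorm[OF \<tau>(1), of x] by (meson mult_right_mono norm_ge_zero order_trans)
  qed
  \<comment> \<open>The two asymptotic hypotheses leave out \<open>s \<le> \<bar>\<tau>\<bar> \<le> b\<close>, where compactness bounds the resolvent.\<close>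
  obtain N where N: "\<And>z x. z \<in> (\<lambda>\<tau>. \<i> * of_real \<tau>) ` ({-b..-s} \<union> {s..b}) \<Longrightarrow> norm (res z x) \<le> N * norm x"
  proof (rule res_bounded_on_compact)
    show "compact ((\<lambda>\<tau>. \<i> * complex_of_real \<tau>) ` ({-b..-s} \<union> {s..b}))"
      by (intro compact_continuous_image continuous_intros compact_Un compact_Icc)
    show "regular z" if "z \<in> (\<lambda>\<tau>. \<i> * of_real \<tau>) ` ({-b..-s} \<union> {s..b})" for z
      using that axis s(1) by fastforce
  qed blast
  define C1 where "C1 = max (max N c') 0"
  have far: "norm (res (\<i> * of_real \<tau>) x) \<le> C1 * norm x" if \<tau>: "\<bar>\<tau>\<bar> \<ge> s" for \<tau> x
  proof (cases "\<bar>\<tau>\<bar> \<le> b")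
    case True
    then have "\<tau> \<in> {-b..-s} \<union> {s..b}" using \<tau> by (auto simp: abs_le_iff abs_if split: if_splits)
    then have "norm (res (\<i> * of_real \<tau>) x) \<le> N * norm x" by (intro N imageI)
    also have "\<dots> \<le> C1 * norm x" by (intro mult_right_mono) (auto simp: C1_def)
    finally show ?thesis .
  next
    case False
    have "\<tau> \<noteq> 0" using \<tau> s(1) by auto
    have "norm (res (\<i> * of_real \<tau>) x) \<le> onorm (inv_into D (\<lambda>x. (\<i> * complex_of_real \<tau>) *\<^sub>C x + A x)) * norm x"
      by (rule res_onorm) fact
    also have "\<dots> \<le> C1 * norm x"
      using b[of \<tau>] False by (intro mult_right_mono) (auto simp: C1_def)
    finally show ?thesis .
  qed
  define C3 where "C3 = K * (1 + 2 * K) + K * (1 + 2 * (1 + K) * (c * C)) + (1 + K) * C1 * (1 + K)"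
  have C1: "C1 \<ge> 0" by (simp add: C1_def)
  have C3: "C3 \<ge> 0" using K_ge_1 c(1) C C1 by (simp add: C3_def)
  show ?thesis
  proof (rule bigoI)
    show "\<forall>\<^sub>F t in at_top. norm (onorm (\<lambda>x. T t (A (inv_into D (\<lambda>y. y + A y) x))))
        \<le> (16 / 3 * exp 1 * K\<^sup>2 * C3) * norm (1 / (t * l (t powr (1 / \<alpha>))) powr (1 / \<alpha>))"
      using rate eventually_gt_at_top[of 0]
    proof eventually_elim
      case (elim t)
      then have r: "r t > 0" "r t * t \<ge> 1" and t: "t > 0" by auto
      have reg: "regular (Complex (1 / t) \<tau>)" for \<tau> by (rule right) (simp add: t)
      have decr: "u * m u \<le> c * C * (r t * t)" if "r t \<le> u" "u \<le> s" for u
      proof -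
        have "u * (1 / (u powr \<alpha> * l (1 / u))) \<le> C * (r t * t)" using elim that s(3) by auto
        from mult_left_mono[OF this, of c] show ?thesis using c(1) by (simp add: m_def mult_ac)
      qed
      have q: "norm (res (Complex (1 / t) \<tau>) (v - res 1 v)) \<le> C3 * (r t * t) * norm v" for \<tau> v
        unfolding C3_def
        by (rule res_complement_bound[OF one t axis reg near far s(1) m0 C1 _ r decr])
          (use c(1) C in auto)
      have "norm (T t (x - res 1 x)) \<le> 16 / 3 * exp 1 * K\<^sup>2 * (C3 * (r t * t)) / t * norm x" for x
        by (rule orbit_decay[OF one t reg _ q]) (use C3 r in simp)
      also have "16 / 3 * exp 1 * K\<^sup>2 * (C3 * (r t * t)) / t = 16 / 3 * exp 1 * K\<^sup>2 * C3 * r t"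
        using t by simp
      finally have bd: "norm (T t (x - res 1 x)) \<le> 16 / 3 * exp 1 * K\<^sup>2 * C3 * r t * norm x" for x .
      have "bounded_linear (\<lambda>x. T t (x - res 1 x))"
        using t by (intro bounded_linear_compose[OF linear_T] bounded_linear_sub bounded_linear_ident
            bounded_linear_res[OF one]) simp
      then have "0 \<le> onorm (\<lambda>x. T t (x - res 1 x))" by (rule onorm_pos_le)
      moreover have "onorm (\<lambda>x. T t (x - res 1 x)) \<le> 16 / 3 * exp 1 * K\<^sup>2 * C3 * r t"
        using C3 r by (intro onorm_bound bd) auto
      ultimately show ?case
        unfolding op r_def[symmetric] using r by simp
    qed
  qed
qed

end
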